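(* Let $\Gamma$ be a finitely generated group acting continuously on a compact metric space $Y$. Assume that the action $\Gamma\curvearrowright Y$ is free and linearisable in a Banach space $E_1$, and that $\Gamma$ has property $PE_2$ for some Banach space $E_2$. Then the warped cone $\mathcal{O}_\Gamma Y$ admits a fibred coarse embedding into $\mathbb{R}\oplus E_1\oplus E_2$.
   Context: Warped cone. Let $\Gamma$ be a group with a fixed finite generating set $S$, acting continuously on a compact metric space $(Y,d)$ with $\operatorname{diam}(Y)>0$. The infinite cone $\mathcal{O}Y$ is $(0,\infty)\times Y$ with the metric $d((r,y),(r',y')) = |r-r'|\cdot\operatorname{diam}(Y)+\min(r,r')\cdot d(y,y')$ and the action $\gamma(r,y)=(r,\gamma y)$. The warped cone $\mathcal{O}_\Gamma Y$ is $\mathcal{O}Y$ equipped with the warped metric $d_\Gamma$: the largest metric on $\mathcal{O}Y$ such that $d_\Gamma\le d$ and $d_\Gamma(x,sx)\le 1$ for all $x\in\mathcal{O}Y$, $s\in S$. Linearisable. An action $\Gamma\curvearrowright Y$ is linearisable in a Banach space $E$ if there exist an isometric (linear) representation of $\Gamma$ on $E$ and a $\Gamma$-equivariant bi-Lipschitz embedding $Y\to E$. Property $PE$. For a Banach space $E$, a finitely generated group $\Gamma$ has property $PE$ if it admits an isometric action by affine maps on $E$ that is metrically proper, i.e. for every orbit map the inverse images of balls are finite. Direct sums of Banach spaces are equipped with an $\ell^q$-sum norm, for any fixed $q\in[1,\infty]$. Fibred coarse embedding. A metric space $X$ admits a fibred coarse embedding into a normed space $E$ if there exist: a field $\{E_x\}_{x\in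 X}$ of isometric copies of $E$; a sequence of sections $f_n\colon X\to\bigsqcup_{x\in X}E_x$ (so $f_n(x)\in E_x$); and non-decreasing unbounded functions $\rho_\pm\colon[0,\infty)\to[0,\infty)$, such that for every $n\in\mathbb{N}$ there exist a bounded subset $K_n\subseteq X$ and, for every $x\in X\setminus K_n$, a trivialisation $\tau_n^x\colon\bigsqcup_{y\in B(x,n)}E_y\to B(x,n)\times E$ with $\tau_n^x(E_y)=\{y\}\times E$, such that, writing $t_n^x$ for the composition of $\tau_n^x$ with the projection onto $E$, the restriction of $t_n^x$ to each $E_y$, $y\in B(x,n)$, is an isometry onto $E$, and: (i) for all $y,y'\in B(x,n)$: $\rho_-(d(y,y'))\le\|t_n^x(f_n(y))-t_n^x(f_n(y'))\|\le\rho_+(d(y,y'))$; (ii) for all $x,x'\in X\setminus K_n$ such that $I=B(x,n)\cap B(x',n)$ is non-empty, there is an isometry $t_n^{x,x'}\colon E\to E$ such that $\mathrm{id}\times t_n^{x,x'}\colon I\times E\to I\times E$ equals the composition $\tau_n^x\circ(\tau_n^{x'})^{-1}$. Free means that $\gamma y=y$ for some $y\in Y$ implies $\gamma=e$. *)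

theory Defs
  imports
    "HOL-Analysis.Analysis"
    "HOL-Algebra.Generated_Groups"
    "HOL-Algebra.Group_Action"
begin

definition finite_generating_set :: "('g, 'm) monoid_scheme \<Rightarrow> 'g set \<Rightarrow> bool" where
  "finite_generating_set G S \<longleftrightarrow> finite S \<and> S \<subseteq> carrier G \<and> generate G S = carrier G"

text \<open>The group is discrete, so an action is continuous iff every element acts by a
  continuous map.\<close>

definition continuous_action ::
  "('g, 'm) monoid_scheme \<Rightarrow> 'y::metric_space set \<Rightarrow> ('g \<Rightarrow> 'y \<Rightarrow> 'y) \<Rightarrow> bool" where
  "continuous_action G Y \<phi> \<longleftrightarrow>
     group_action G Y \<phi> \<and> (\<forall>g\<in>carrier G. continuous_on Y (\<phi> g))"

definition free_action ::
  "('g, 'm) monoid_scheme \<Rightarrow> 'y set \<Rightarrow> ('g \<Rightarrow> 'y \<Rightarrow> 'y) \<Rightarrow> bool" where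
  "free_action G Y \<phi> \<longleftrightarrow> (\<forall>g\<in>carrier G. \<forall>y\<in>Y. \<phi> g y = y \<longrightarrow> g = \<one>\<^bsub>G\<^esub>)"


section \<open>Warped cones\<close>

definition infinite_cone :: "'y set \<Rightarrow> (real \<times> 'y) set" where
  "infinite_cone Y = {0<..} \<times> Y"

definition cone_dist :: "'y::metric_space set \<Rightarrow> real \<times> 'y \<Rightarrow> real \<times> 'y \<Rightarrow> real" where
  "cone_dist Y p q =
     \<bar>fst p - fst q\<bar> * diameter Y + min (fst p) (fst q) * dist (snd p) (snd q)"

definition cone_action :: "('g \<Rightarrow> 'y \<Rightarrow> 'y) \<Rightarrow> 'g \<Rightarrow> real \<times> 'y \<Rightarrow> real \<times> 'y" where
  "cone_action \<phi> g p = (fst p, \<phi> g (snd p))"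

definition warping_metric ::
  "'g set \<Rightarrow> 'y::metric_space set \<Rightarrow> ('g \<Rightarrow> 'y \<Rightarrow> 'y) \<Rightarrow> (real \<times> 'y \<Rightarrow> real \<times> 'y \<Rightarrow> real) \<Rightarrow> bool"
  where
  "warping_metric S Y \<phi> \<delta> \<longleftrightarrow>
     Metric_space (infinite_cone Y) \<delta> \<and>
     (\<forall>p\<in>infinite_cone Y. \<forall>q\<in>infinite_cone Y. \<delta> p q \<le> cone_dist Y p q) \<and>
     (\<forall>p\<in>infinite_cone Y. \<forall>s\<in>S. \<delta> p (cone_action \<phi> s p) \<le> 1)"

definition largest_warping_metric ::
  "'g set \<Rightarrow> 'y::metric_space set \<Rightarrow> ('g \<Rightarrow> 'y \<Rightarrow> 'y) \<Rightarrow> (real \<times> 'y \<Rightarrow> real \<times> 'y \<Rightarrow> real) \<Rightarrow> bool"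
  where
  "largest_warping_metric S Y \<phi> \<delta> \<longleftrightarrow>
     warping_metric S Y \<phi> \<delta> \<and>
     (\<forall>\<delta>'. warping_metric S Y \<phi> \<delta>' \<longrightarrow> (\<forall>p\<in>infinite_cone Y. \<forall>q\<in>infinite_cone Y. \<delta>' p q \<le> \<delta> p q))"

text \<open>The largest metric exists and is unique on the cone (lemmas below); only its
  irrelevant values off the cone are left to the choice operator.\<close>

definition warped_dist ::
  "'g set \<Rightarrow> 'y::metric_space set \<Rightarrow> ('g \<Rightarrow> 'y \<Rightarrow> 'y) \<Rightarrow> real \<times> 'y \<Rightarrow> real \<times> 'y \<Rightarrow> real" where
  "warped_dist S Y \<phi> = (SOME \<delta>. largest_warping_metric S Y \<phi> \<delta>)"

lemma largest_warping_metric_unique: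
  assumes "largest_warping_metric S Y \<phi> \<delta>" "largest_warping_metric S Y \<phi> \<delta>'"
    and "p \<in> infinite_cone Y" "q \<in> infinite_cone Y"
  shows "\<delta> p q = \<delta>' p q"
  using assms unfolding largest_warping_metric_def by (meson order_antisym)

lemma cone_dist_commute: "cone_dist Y p q = cone_dist Y q p"
  by (simp add: cone_dist_def abs_minus_commute min.commute dist_commute)

lemma cone_dist_nonneg:
  assumes "diameter Y > 0" "p \<in> infinite_cone Y" "q \<in> infinite_cone Y"
  shows "0 \<le> cone_dist Y p q"
  using assms by (auto simp: cone_dist_def infinite_cone_def)

lemma cone_dist_eq_0:
  assumes "diameter Y > 0" "p \<in> infinite_cone Y" "q \<in> infinite_cone Y"
  shows "cone_dist Y p q = 0 \<longleftrightarrow> p = q"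
proof
  assume h: "cone_dist Y p q = 0"
  have a: "0 \<le> \<bar>fst p - fst q\<bar> * diameter Y" using assms by simp
  have m: "0 < min (fst p) (fst q)" using assms by (auto simp: infinite_cone_def)
  have b: "0 \<le> min (fst p) (fst q) * dist (snd p) (snd q)" using m by simp
  from h a b have "\<bar>fst p - fst q\<bar> * diameter Y = 0" "min (fst p) (fst q) * dist (snd p) (snd q) = 0"
    unfolding cone_dist_def by linarith+
  then show "p = q" using assms(1) m by (auto simp: prod_eq_iff)
qed (simp add: cone_dist_def)

lemma cone_dist_triangle:
  assumes "compact Y" "diameter Y > 0" "p \<in> infinite_cone Y" "q \<in> infinite_cone Y" "w \<in> infinite_cone Y"
  shows "cone_dist Y p w \<le> cone_dist Y p q + cone_dist Y q w"
proof -
  obtain r x where p: "p = (r, x)" "r > 0" "x \<in> Y" using assms by (auto simp: infinite_cone_def)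
  obtain s y where q: "q = (s, y)" "s > 0" "y \<in> Y" using assms by (auto simp: infinite_cone_def)
  obtain t z where w: "w = (t, z)" "t > 0" "z \<in> Y" using assms by (auto simp: infinite_cone_def)
  define D where "D = diameter Y"
  have D: "D > 0" using assms D_def by simp
  have dz: "dist x z \<le> D"
    unfolding D_def using diameter_bounded_bound[OF compact_imp_bounded[OF assms(1)]] p w by simp
  define m where "m = min r t"
  have "m * dist x z \<le> (m - min s m) * D + min s m * dist x z"
  proof -
    have "(m - min s m) * dist x z \<le> (m - min s m) * D"
      by (rule mult_left_mono[OF dz]) simp
    then show ?thesis by (simp add: algebra_simps)
  qed
  moreover have "min s m * dist x z \<le> min r s * dist x y + min s t * dist y z"
  proof -
    have "min s m * dist x z \<le> min s m * (dist x y + dist y z)"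
      by (rule mult_left_mono[OF dist_triangle]) (use p q w in \<open>simp add: m_def\<close>)
    also have "\<dots> = min s m * dist x y + min s m * dist y z" by (simp add: algebra_simps)
    also have "\<dots> \<le> min r s * dist x y + min s t * dist y z"
      by (intro add_mono mult_right_mono) (auto simp: m_def)
    finally show ?thesis .
  qed
  moreover have "\<bar>r - t\<bar> * D + (m - min s m) * D \<le> \<bar>r - s\<bar> * D + \<bar>s - t\<bar> * D"
  proof -
    have "\<bar>r - t\<bar> + (m - min s m) \<le> \<bar>r - s\<bar> + \<bar>s - t\<bar>" unfolding m_def by linarith
    from mult_right_mono[OF this, of D] D show ?thesis by (simp add: distrib_right)
  qed
  ultimately show ?thesis
    unfolding cone_dist_def p q w D_def[symmetric] by (simp add: m_def)
qed

lemma warping_metric_exists: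
  assumes "compact Y" "diameter Y > 0"
  shows "\<exists>\<delta>. warping_metric S Y \<phi> \<delta>"
proof
  let ?\<delta> = "\<lambda>p q. if p \<in> infinite_cone Y \<and> q \<in> infinite_cone Y then min 1 (cone_dist Y p q) else 0"
  have "Metric_space (infinite_cone Y) ?\<delta>"
  proof
    fix p q w
    show "0 \<le> ?\<delta> p q" using cone_dist_nonneg[OF assms(2)] by simp
    show "?\<delta> p q = ?\<delta> q p" by (simp add: cone_dist_commute)
    show "?\<delta> p q = 0 \<longleftrightarrow> p = q" if "p \<in> infinite_cone Y" "q \<in> infinite_cone Y"
      using that cone_dist_eq_0[OF assms(2) that] by (auto simp: min_def)
    show "?\<delta> p w \<le> ?\<delta> p q + ?\<delta> q w" if "p \<in> infinite_cone Y" "q \<in> infinite_cone Y" "w \<in> infinite_cone Y"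
      using that cone_dist_triangle[OF assms that] cone_dist_nonneg[OF assms(2)]
      by (smt (verit))
  qed
  then show "warping_metric S Y \<phi> ?\<delta>" by (auto simp: warping_metric_def)
qed

lemma largest_warping_metric_exists:
  assumes "compact Y" "diameter Y > 0" "\<forall>s\<in>S. \<phi> s ` Y \<subseteq> Y"
  shows "\<exists>\<delta>. largest_warping_metric S Y \<phi> \<delta>"
proof
  define P where "P = warping_metric S Y \<phi>"
  let ?D = "\<lambda>p q. if p \<in> infinite_cone Y \<and> q \<in> infinite_cone Y then (SUP \<delta>\<in>Collect P. \<delta> p q) else 0"
  obtain \<delta>0 where \<delta>0: "P \<delta>0" using warping_metric_exists[OF assms(1,2)] unfolding P_def by blast
  have ne: "Collect P \<noteq> {}" using \<delta>0 by blast
  have M: "Metric_space (infinite_cone Y) \<delta>" if "P \<delta>" for \<delta>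
    using that by (simp add: P_def warping_metric_def)
  have le: "\<delta> p q \<le> cone_dist Y p q" if "P \<delta>" "p \<in> infinite_cone Y" "q \<in> infinite_cone Y" for \<delta> p q
    using that by (simp add: P_def warping_metric_def)
  have bdd: "bdd_above ((\<lambda>\<delta>. \<delta> p q) ` Collect P)" if "p \<in> infinite_cone Y" "q \<in> infinite_cone Y" for p q
    by (rule bdd_aboveI2[where M = "cone_dist Y p q"]) (use le that in auto)
  have up: "\<delta> p q \<le> ?D p q" if "P \<delta>" "p \<in> infinite_cone Y" "q \<in> infinite_cone Y" for \<delta> p q
    using cSUP_upper[OF _ bdd[OF that(2,3)], of \<delta>] that by simp
  have low: "?D p q \<le> B" if "\<And>\<delta>. P \<delta> \<Longrightarrow> \<delta> p q \<le> B" "p \<in> infinite_cone Y" "q \<in> infinite_cone Y" for p q B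
    using cSUP_least[OF ne, of "\<lambda>\<delta>. \<delta> p q" B] that by simp
  have "Metric_space (infinite_cone Y) ?D"
  proof
    fix p q w
    show "0 \<le> ?D p q"
      using up[OF \<delta>0, of p q] Metric_space.nonneg[OF M[OF \<delta>0], of p q] by fastforce
    have "(\<lambda>\<delta>. \<delta> p q) ` Collect P = (\<lambda>\<delta>. \<delta> q p) ` Collect P"
      by (rule image_cong) (use Metric_space.commute[OF M] in auto)
    then show "?D p q = ?D q p" by auto
    show "?D p q = 0 \<longleftrightarrow> p = q" if pq: "p \<in> infinite_cone Y" "q \<in> infinite_cone Y"
    proof
      assume "?D p q = 0"
      then have "\<delta>0 p q \<le> 0" using up[OF \<delta>0 pq] by simp
      then have "\<delta>0 p q = 0" using Metric_space.nonneg[OF M[OF \<delta>0], of p q] by simp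
      then show "p = q" using Metric_space.zero[OF M[OF \<delta>0] pq] by simp
    next
      assume e: "p = q"
      have "?D p q \<le> 0"
      proof (rule low[OF _ pq])
        fix \<delta> assume "P \<delta>"
        then show "\<delta> p q \<le> 0" using Metric_space.zero[OF M pq] e by force
      qed
      then show "?D p q = 0" using \<open>0 \<le> ?D p q\<close> by linarith
    qed
    show "?D p w \<le> ?D p q + ?D q w" if pqw: "p \<in> infinite_cone Y" "q \<in> infinite_cone Y" "w \<in> infinite_cone Y"
    proof (rule low[OF _ pqw(1,3)])
      fix \<delta> assume d: "P \<delta>"
      show "\<delta> p w \<le> ?D p q + ?D q w"
        using Metric_space.triangle[OF M[OF d] pqw] up[OF d pqw(1,2)] up[OF d pqw(2,3)]
        by linarith
    qed
  qed
  moreover have "\<forall>p\<in>infinite_cone Y. \<forall>q\<in>infinite_cone Y. ?D p q \<le> cone_dist Y p q"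
    using low le by blast
  moreover have "\<forall>p\<in>infinite_cone Y. \<forall>s\<in>S. ?D p (cone_action \<phi> s p) \<le> 1"
  proof (intro ballI)
    fix p s assume ps: "p \<in> infinite_cone Y" "s \<in> S"
    then have "cone_action \<phi> s p \<in> infinite_cone Y"
      using assms(3) by (auto simp: infinite_cone_def cone_action_def image_subset_iff)
    then show "?D p (cone_action \<phi> s p) \<le> 1"
      by (intro low) (use ps in \<open>auto simp: P_def warping_metric_def\<close>)
  qed
  ultimately show "largest_warping_metric S Y \<phi> ?D"
    using up unfolding largest_warping_metric_def P_def warping_metric_def by blast
qed

lemma largest_warping_metric_warped_dist:
  assumes "compact Y" "diameter Y > 0" "continuous_action G Y \<phi>" "finite_generating_set G S"
  shows "largest_warping_metric S Y \<phi> (warped_dist S Y \<phi>)"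
proof -
  have "\<forall>s\<in>S. \<phi> s ` Y \<subseteq> Y"
  proof
    fix s assume "s \<in> S"
    then have "s \<in> carrier G" using assms(4) by (auto simp: finite_generating_set_def)
    moreover have "group_action G Y \<phi>" using assms(3) by (simp add: continuous_action_def)
    ultimately show "\<phi> s ` Y \<subseteq> Y" using group_action.surj_prop by fastforce
  qed
  from largest_warping_metric_exists[OF assms(1,2) this] show ?thesis
    unfolding warped_dist_def by (rule someI_ex)
qed


section \<open>Actions on Banach spaces\<close>

definition isometric_representation ::
  "('g, 'm) monoid_scheme \<Rightarrow> ('g \<Rightarrow> 'e \<Rightarrow> 'e::banach) \<Rightarrow> bool" where
  "isometric_representation G \<pi> \<longleftrightarrow>
     group_action G UNIV \<pi> \<and>
     (\<forall>g\<in>carrier G. linear (\<pi> g) \<and> (\<forall>v. norm (\<pi> g v) = norm v))"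

definition bi_lipschitz_embedding ::
  "'y::metric_space set \<Rightarrow> ('y \<Rightarrow> 'e::metric_space) \<Rightarrow> bool" where
  "bi_lipschitz_embedding Y f \<longleftrightarrow>
     (\<exists>c>0. \<exists>C>0. \<forall>y\<in>Y. \<forall>y'\<in>Y.
        c * dist y y' \<le> dist (f y) (f y') \<and> dist (f y) (f y') \<le> C * dist y y')"

definition linearisable_in ::
  "('g, 'm) monoid_scheme \<Rightarrow> 'y::metric_space set \<Rightarrow> ('g \<Rightarrow> 'y \<Rightarrow> 'y) \<Rightarrow> 'e::banach itself \<Rightarrow> bool"
  where
  "linearisable_in G Y \<phi> TYPE('e) \<longleftrightarrow>
     (\<exists>(\<pi> :: 'g \<Rightarrow> 'e \<Rightarrow> 'e) (f :: 'y \<Rightarrow> 'e).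
        isometric_representation G \<pi> \<and>
        bi_lipschitz_embedding Y f \<and>
        (\<forall>g\<in>carrier G. \<forall>y\<in>Y. f (\<phi> g y) = \<pi> g (f y)))"

definition isometric_affine_action ::
  "('g, 'm) monoid_scheme \<Rightarrow> ('g \<Rightarrow> 'e \<Rightarrow> 'e::banach) \<Rightarrow> bool" where
  "isometric_affine_action G \<alpha> \<longleftrightarrow>
     group_action G UNIV \<alpha> \<and>
     (\<forall>g\<in>carrier G.
        (\<exists>L b. linear L \<and> (\<forall>v. \<alpha> g v = L v + b)) \<and>
        (\<forall>u v. dist (\<alpha> g u) (\<alpha> g v) = dist u v))"

definition property_PE :: "('g, 'm) monoid_scheme \<Rightarrow> 'e::banach itself \<Rightarrow> bool" where
  "property_PE G TYPE('e) \<longleftrightarrow>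
     (\<exists>\<alpha> :: 'g \<Rightarrow> 'e \<Rightarrow> 'e.
        isometric_affine_action G \<alpha> \<and>
        (\<forall>v w r. finite {g \<in> carrier G. \<alpha> g v \<in> ball w r}))"

text \<open>The norm of the \<open>\<ell>\<^sup>q\<close>-sum, for \<open>q \<in> [1, \<infinity>]\<close>.  It is a
  parameter in its own right, since the norm of the product type is the case \<open>q = 2\<close> only.\<close>

definition lq_sum_norm ::
  "ereal \<Rightarrow> real \<times> 'e1::real_normed_vector \<times> 'e2::real_normed_vector \<Rightarrow> real" where
  "lq_sum_norm q = (\<lambda>(t, u, v).
     if q = \<infinity> then Max {\<bar>t\<bar>, norm u, norm v}
     else (\<bar>t\<bar> powr real_of_ereal q + norm u powr real_of_ereal q + norm v powr real_of_ereal q)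
            powr (1 / real_of_ereal q))"


section \<open>Fibred coarse embeddings\<close>

definition isometry_onto ::
  "'a set \<Rightarrow> ('a \<Rightarrow> 'a \<Rightarrow> real) \<Rightarrow> 'b set \<Rightarrow> ('b \<Rightarrow> 'b \<Rightarrow> real) \<Rightarrow> ('a \<Rightarrow> 'b) \<Rightarrow> bool" where
  "isometry_onto A dA B dB h \<longleftrightarrow>
     bij_betw h A B \<and> (\<forall>u\<in>A. \<forall>v\<in>A. dB (h u) (h v) = dA u v)"

definition norm_dist :: "('e::real_vector \<Rightarrow> real) \<Rightarrow> 'e \<Rightarrow> 'e \<Rightarrow> real" where
  "norm_dist N u v = N (u - v)"

definition control_function :: "(real \<Rightarrow> real) \<Rightarrow> bool" where
  "control_function \<rho> \<longleftrightarrow>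
     \<rho> ` {0..} \<subseteq> {0..} \<and> mono_on {0..} \<rho> \<and> \<not> bdd_above (\<rho> ` {0..})"

text \<open>The fibre over \<open>y\<close> is the metric space with carrier \<open>F y\<close> and metric
  \<open>\<delta> y\<close>, and the disjoint union of the fibres over \<open>B\<close> is the dependent sum
  \<open>Sigma B F\<close>.\<close>

definition trivialisation ::
  "('e::real_vector \<Rightarrow> real) \<Rightarrow> ('x \<Rightarrow> 'e set) \<Rightarrow> ('x \<Rightarrow> 'e \<Rightarrow> 'e \<Rightarrow> real) \<Rightarrow> 'x set \<Rightarrow>
     ('x \<times> 'e \<Rightarrow> 'x \<times> 'e) \<Rightarrow> bool" where
  "trivialisation N F \<delta> B \<tau> \<longleftrightarrow>
     (\<forall>y\<in>B. \<tau> ` ({y} \<times> F y) = {y} \<times> UNIV \<and>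
             isometry_onto (F y) (\<delta> y) UNIV (norm_dist N) (\<lambda>u. snd (\<tau> (y, u))))"

text \<open>A fibred coarse embedding of the metric space \<open>(X, d)\<close> into the real vector space
  \<open>'e\<close> normed by \<open>N\<close>.  The carriers of the fibres are subsets of \<open>'e\<close>, which
  loses no generality: being isometric to \<open>'e\<close>, a fibre is in bijection with it.
  A section \<open>f n\<close> is represented by its fibre components, so its value at \<open>x\<close> in
  the disjoint union is \<open>(x, f n x)\<close>.  Balls are closed; as the condition is imposed for
  every \<open>n\<close>, open balls give the same notion after shifting \<open>n\<close> by one.\<close>

definition fibred_coarsely_embeds ::
  "'x set \<Rightarrow> ('x \<Rightarrow> 'x \<Rightarrow> real) \<Rightarrow> ('e::real_vector \<Rightarrow> real) \<Rightarrow> bool" where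
  "fibred_coarsely_embeds X d N \<longleftrightarrow>
     (\<exists>(F :: 'x \<Rightarrow> 'e set) (\<delta> :: 'x \<Rightarrow> 'e \<Rightarrow> 'e \<Rightarrow> real)
       (f :: nat \<Rightarrow> 'x \<Rightarrow> 'e) \<rho>m \<rho>p.
        (\<forall>x\<in>X. \<exists>h. isometry_onto (F x) (\<delta> x) UNIV (norm_dist N) h) \<and>
        (\<forall>n. f n \<in> Pi X F) \<and>
        control_function \<rho>m \<and> control_function \<rho>p \<and>
        (\<forall>n::nat. \<exists>K \<tau>. let B = (\<lambda>x. Metric_space.mcball X d x (real n)) in
           K \<subseteq> X \<and> Metric_space.mbounded X d K \<and>
           (\<forall>x\<in>X - K. trivialisation N F \<delta> (B x) (\<tau> x)) \<and>
           (\<forall>x\<in>X - K. \<forall>y\<in>B x. \<forall>y'\<in>B x.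
              let a = norm_dist N (snd (\<tau> x (y, f n y))) (snd (\<tau> x (y', f n y')))
              in \<rho>m (d y y') \<le> a \<and> a \<le> \<rho>p (d y y')) \<and>
           (\<forall>x\<in>X - K. \<forall>x'\<in>X - K. B x \<inter> B x' \<noteq> {} \<longrightarrow>
              (\<exists>t. isometry_onto UNIV (norm_dist N) UNIV (norm_dist N) t \<and>
                 (\<forall>y\<in>B x \<inter> B x'. \<forall>e.
                    \<tau> x (inv_into (Sigma (B x') F) (\<tau> x') (y, e)) = (y, t e))))))"

end

theory Submission
  imports Defs
begin

text \<open>
  Let \<open>\<pi>\<close> and \<open>f\<close> linearise the action in \<open>E\<^sub>1\<close>, and let \<open>\<alpha>\<close> be a proper affine isometric action
  on \<open>E\<^sub>2\<close>.  Pulling back the norm along \<open>(r, y) \<mapsto> (r, r f(y))\<close> gives a metric on the cone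
  which is bi-Lipschitz to the cone metric and, because \<open>\<pi>\<close> is isometric and \<open>f\<close> equivariant,
  invariant under the group (\<open>lin_dist\<close>).  For an invariant metric warping is easy to undo:
  the infimum over \<open>g\<close> of the word length of \<open>g\<close> plus the distance from \<open>g p\<close> to \<open>q\<close> satisfies
  the triangle inequality, hence is a warping metric and lies below the largest one.
  So, up to an arbitrarily small error, the warped distance is realised by a single group element
  followed by a single move in the cone, measured in the invariant metric (\<open>unwarped_lt_wd\<close>, \<open>wd_le_unwarped\<close>).

  Freeness and compactness make this group element unique once the height \<open>r\<close> is large
  compared with the distances involved: distinct short elements move every point of \<open>Y\<close>
  a definite amount apart, and the cone stretches this amount by \<open>r\<close> (\<open>sheets_separate\<close>).
  Therefore a ball of radius \<open>n\<close> around a high point \<open>x\<close> unfolds: each of its points \<open>y\<close> lies near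
  \<open>g x\<close> for exactly one short \<open>g\<close>, the sheet of \<open>y\<close> over \<open>x\<close>.

  All fibres are \<open>\<real> \<oplus> E\<^sub>1 \<oplus> E\<^sub>2\<close>, the section is \<open>(r, y) \<mapsto> (r, r f(y), 0)\<close>, and the trivialisation over the ball
  around \<open>x\<close> applies the inverse of the sheet to the fibre over \<open>y\<close>, the group acting on
  \<open>\<real> \<oplus> E\<^sub>1 \<oplus> E\<^sub>2\<close> by \<open>id \<times> \<pi> \<times> \<alpha>\<close>.
  Two points of the ball whose sheets differ by \<open>h\<close> are then sent to points whose
  distance is comparable with the invariant distance after moving by \<open>h\<close> plus the displacement
  of \<open>0\<close> under \<open>\<alpha>\<close>.  The displacement grows at most linearly with the length of \<open>h\<close>, and by
  properness it bounds that length (\<open>control_functions\<close>).  The transition between two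
  trivialisations at \<open>y\<close> is the action of a quotient of sheets, and uniqueness, at a larger
  scale, shows that it does not depend on \<open>y\<close>.
\<close>

section \<open>Word length\<close>

primrec word_ball :: "('g, 'm) monoid_scheme \<Rightarrow> 'g set \<Rightarrow> nat \<Rightarrow> 'g set" where
  "word_ball G S 0 = {\<one>\<^bsub>G\<^esub>}"
| "word_ball G S (Suc n) =
     word_ball G S n \<union> (\<Union>s\<in>S \<union> m_inv G ` S. (\<lambda>g. s \<otimes>\<^bsub>G\<^esub> g) ` word_ball G S n)"

definition word_length :: "('g, 'm) monoid_scheme \<Rightarrow> 'g set \<Rightarrow> 'g \<Rightarrow> nat" where
  "word_length G S g = (LEAST n. g \<in> word_ball G S n)"

locale generated_group = group G for G :: "('g, 'm) monoid_scheme" (structure) +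
  fixes S :: "'g set"
  assumes generating: "finite_generating_set G S"
begin

abbreviation letters :: "'g set" where "letters \<equiv> S \<union> m_inv G ` S"
abbreviation len :: "'g \<Rightarrow> nat" where "len \<equiv> word_length G S"

lemma finite_letters: "finite letters"
  using generating by (simp add: finite_generating_set_def)

lemma letters_carrier: "s \<in> letters \<Longrightarrow> s \<in> carrier G"
  using generating by (auto simp: finite_generating_set_def)

lemma inv_letters: "s \<in> letters \<Longrightarrow> inv s \<in> letters"
  using generating by (auto simp: finite_generating_set_def subset_iff)

lemma word_ball_carrier: "word_ball G S n \<subseteq> carrier G"
  by (induction n) (use letters_carrier in auto)

lemma finite_word_ball: "finite (word_ball G S n)"
  by (induction n) (use finite_letters in auto)

lemma word_ball_mono: "m \<le> n \<Longrightarrow> word_ball G S m \<subseteq> word_ball G S n"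
  by (rule lift_Suc_mono_le[of "word_ball G S"]) auto

lemma word_ball_mult:
  assumes "x \<in> word_ball G S m" "y \<in> word_ball G S n"
  shows "x \<otimes> y \<in> word_ball G S (m + n)"
  using assms(1)
proof (induction m arbitrary: x)
  case 0
  then show ?case using assms(2) word_ball_carrier[of n] by (auto simp: subset_iff)
next
  case (Suc m)
  show ?case
  proof (cases "x \<in> word_ball G S m")
    case True
    then show ?thesis using Suc.IH by auto
  next
    case False
    then obtain s z where s: "s \<in> letters" "z \<in> word_ball G S m" "x = s \<otimes> z"
      using Suc.prems by auto
    have "x \<otimes> y = s \<otimes> (z \<otimes> y)"
      using s letters_carrier[OF s(1)] assms(2) word_ball_carrier by (simp add: m_assoc subset_iff)
    then show ?thesis using s(1) Suc.IH[OF s(2)] by auto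
  qed
qed

lemma letters_word_ball: "s \<in> letters \<Longrightarrow> s \<in> word_ball G S 1"
  using letters_carrier by force

lemma word_ball_inv: "x \<in> word_ball G S n \<Longrightarrow> inv x \<in> word_ball G S n"
proof (induction n arbitrary: x)
  case 0
  then show ?case by simp
next
  case (Suc n)
  show ?case
  proof (cases "x \<in> word_ball G S n")
    case True
    then show ?thesis using Suc.IH by auto
  next
    case False
    then obtain s z where s: "s \<in> letters" "z \<in> word_ball G S n" "x = s \<otimes> z"
      using Suc.prems by auto
    have "inv x = inv z \<otimes> inv s"
      using s letters_carrier[OF s(1)] word_ball_carrier by (simp add: inv_mult_group subset_iff)
    then show ?thesis
      using word_ball_mult[OF Suc.IH[OF s(2)] letters_word_ball[OF inv_letters[OF s(1)]]] by simp
  qed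
qed

lemma word_ball_exhausts: "g \<in> carrier G \<Longrightarrow> \<exists>n. g \<in> word_ball G S n"
proof -
  assume "g \<in> carrier G"
  then have "g \<in> generate G S" using generating by (simp add: finite_generating_set_def)
  then show ?thesis
  proof (induction rule: generate.induct)
    case one
    show ?case by (rule exI[of _ 0]) simp
  next
    case (incl h)
    then show ?case using letters_word_ball by blast
  next
    case (inv h)
    then show ?case using letters_word_ball by blast
  next
    case (eng h1 h2)
    then show ?case using word_ball_mult by blast
  qed
qed

lemma word_length_le_iff:
  assumes "g \<in> carrier G" shows "len g \<le> n \<longleftrightarrow> g \<in> word_ball G S n"
proof
  assume "len g \<le> n"
  moreover have "g \<in> word_ball G S (len g)"
    unfolding word_length_def by (rule LeastI_ex) (rule word_ball_exhausts[OF assms])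
  ultimately show "g \<in> word_ball G S n" using word_ball_mono by blast
next
  assume "g \<in> word_ball G S n"
  then show "len g \<le> n" unfolding word_length_def by (rule Least_le)
qed

lemma word_length_one [simp]: "len \<one> = 0"
  using word_length_le_iff[of \<one> 0] by simp

lemma word_length_eq_0: "g \<in> carrier G \<Longrightarrow> len g = 0 \<Longrightarrow> g = \<one>"
  using word_length_le_iff[of g 0] by simp

lemma word_length_mult:
  "g \<in> carrier G \<Longrightarrow> h \<in> carrier G \<Longrightarrow> len (g \<otimes> h) \<le> len g + len h"
  using word_ball_mult[of g "len g" h "len h"] by (simp flip: word_length_le_iff)

lemma word_length_inv [simp]:
  assumes "g \<in> carrier G" shows "len (inv g) = len g"
proof -
  have *: "len (inv g) \<le> len g" if "g \<in> carrier G" for g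
    using that word_ball_inv[of g "len g"] by (simp flip: word_length_le_iff)
  show ?thesis using *[OF assms] *[of "inv g"] assms by simp
qed

lemma word_length_letter: "s \<in> letters \<Longrightarrow> len s \<le> 1"
  using letters_word_ball letters_carrier by (simp only: word_length_le_iff)

text \<open>The word length dominates every quantity that a letter increases by at most a constant.
  With displacements for \<open>\<omega>\<close> this yields the upper estimates for the warped metric and
  for the affine action.\<close>

lemma le_word_length:
  fixes \<omega> :: "'g \<Rightarrow> real" and V :: real
  assumes one: "\<omega> \<one> \<le> 0"
    and step: "\<And>s g. s \<in> letters \<Longrightarrow> g \<in> carrier G \<Longrightarrow> \<omega> (s \<otimes> g) \<le> V + \<omega> g"
    and V: "0 \<le> V" and g: "g \<in> carrier G"
  shows "\<omega> g \<le> V * len g"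
proof -
  have "g \<in> word_ball G S n \<Longrightarrow> \<omega> g \<le> V * n" for n g
  proof (induction n arbitrary: g)
    case 0
    then show ?case using one by simp
  next
    case (Suc n)
    show ?case
    proof (cases "g \<in> word_ball G S n")
      case True
      then show ?thesis using Suc.IH[OF True] V by (simp add: algebra_simps)
    next
      case False
      then obtain s z where s: "s \<in> letters" "z \<in> word_ball G S n" "g = s \<otimes> z"
        using Suc.prems by auto
      then show ?thesis
        using step[OF s(1), of z] Suc.IH[OF s(2)] word_ball_carrier[of n]
        by (simp add: algebra_simps subset_iff)
    qed
  qed
  then show ?thesis using g word_length_le_iff by blast
qed

end


section \<open>Unwarping the warped metric\<close>

locale cone_over_action = generated_group G S for G :: "('g, 'm) monoid_scheme" (structure) and S +
  fixes Y :: "'y::metric_space set" and \<phi> :: "'g \<Rightarrow> 'y \<Rightarrow> 'y"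
  assumes compact: "compact Y" and diam: "diameter Y > 0"
    and action: "continuous_action G Y \<phi>"
begin

abbreviation X :: "(real \<times> 'y) set" where "X \<equiv> infinite_cone Y"
abbreviation act :: "'g \<Rightarrow> real \<times> 'y \<Rightarrow> real \<times> 'y" where "act \<equiv> cone_action \<phi>"
abbreviation wd :: "real \<times> 'y \<Rightarrow> real \<times> 'y \<Rightarrow> real" where "wd \<equiv> warped_dist S Y \<phi>"

lemma Y_nonempty: "Y \<noteq> {}"
  using diam by (auto simp: diameter_def)

lemma group_action: "group_action G Y \<phi>"
  using action by (simp add: continuous_action_def)

lemma action_closed: "g \<in> carrier G \<Longrightarrow> y \<in> Y \<Longrightarrow> \<phi> g y \<in> Y"
  using group_action.surj_prop[OF group_action] by blast

lemma act_closed [simp]: "g \<in> carrier G \<Longrightarrow> p \<in> X \<Longrightarrow> act g p \<in> X"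
  using action_closed by (auto simp: infinite_cone_def cone_action_def)

lemma act_mult: "g \<in> carrier G \<Longrightarrow> h \<in> carrier G \<Longrightarrow> p \<in> X \<Longrightarrow> act (g \<otimes> h) p = act g (act h p)"
  using group_action.composition_rule[OF group_action]
  by (auto simp: infinite_cone_def cone_action_def)

lemma act_one [simp]: "p \<in> X \<Longrightarrow> act \<one> p = p"
  using group_action.id_eq_one[OF group_action]
  by (auto simp: infinite_cone_def cone_action_def restrict_def fun_eq_iff split: if_splits)

lemma act_inv [simp]:
  "g \<in> carrier G \<Longrightarrow> p \<in> X \<Longrightarrow> act (inv g) (act g p) = p"
  "g \<in> carrier G \<Longrightarrow> p \<in> X \<Longrightarrow> act g (act (inv g) p) = p"
  by (simp_all flip: act_mult)

lemma largest_wd: "largest_warping_metric S Y \<phi> wd"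
  using largest_warping_metric_warped_dist[OF compact diam action generating] .

sublocale wd: Metric_space X wd
  using largest_wd by (simp add: largest_warping_metric_def warping_metric_def)

lemma wd_le_cone_dist: "p \<in> X \<Longrightarrow> q \<in> X \<Longrightarrow> wd p q \<le> cone_dist Y p q"
  using largest_wd by (simp add: largest_warping_metric_def warping_metric_def)

lemma wd_letter:
  assumes "p \<in> X" "s \<in> letters" shows "wd p (act s p) \<le> 1"
proof -
  have gen: "wd p (act s p) \<le> 1" if "p \<in> X" "s \<in> S" for p s
    using largest_wd that by (simp add: largest_warping_metric_def warping_metric_def)
  show ?thesis
  proof (cases "s \<in> S")
    case True
    then show ?thesis using gen assms by simp
  next
    case False
    then obtain s' where s': "s' \<in> S" "s = inv s'" using assms by auto
    have c: "s' \<in> carrier G" using s' letters_carrier by auto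
    have "wd (act s p) (act s' (act s p)) \<le> 1"
      using gen[of "act s p" s'] s' c assms by simp
    then show ?thesis using s' c assms by (simp add: wd.commute)
  qed
qed

text \<open>Spell \<open>g\<close> letter by letter, each costing at most one, and finish inside the cone.\<close>

lemma wd_le_unwarped:
  assumes "g \<in> carrier G" "p \<in> X" "q \<in> X"
  shows "wd p q \<le> len g + cone_dist Y (act g p) q"
proof -
  have "wd p (act g p) \<le> 1 * real (len g)"
  proof (rule le_word_length[where \<omega> = "\<lambda>h. wd p (act h p)"])
    fix s h assume s: "s \<in> letters" "h \<in> carrier G"
    show "wd p (act (s \<otimes> h) p) \<le> 1 + wd p (act h p)"
      using wd.triangle[of p "act h p" "act s (act h p)"] wd_letter[OF _ s(1), of "act h p"]
        s letters_carrier[OF s(1)] assms by (simp add: act_mult)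
  qed (use assms in auto)
  then show ?thesis
    using wd.triangle[of p "act g p" q] wd_le_cone_dist[of "act g p" q] assms by simp
qed

text \<open>The infimum of the left-hand side over \<open>g\<close> is itself a warping metric.  Invariance of \<open>D\<close> enters in
  the triangle inequality and in the symmetry: it allows group elements to be moved past
  steps in the cone, so that a zigzag path is straightened into one element and one step.  Points at
  infimum zero coincide because word length takes integer values.\<close>

lemma unwarped_lt_wd:
  fixes D :: "real \<times> 'y \<Rightarrow> real \<times> 'y \<Rightarrow> real"
  assumes D: "Metric_space X D"
    and inv: "\<And>g p q. g \<in> carrier G \<Longrightarrow> p \<in> X \<Longrightarrow> q \<in> X \<Longrightarrow> D (act g p) (act g q) = D p q"
    and le: "\<And>p q. p \<in> X \<Longrightarrow> q \<in> X \<Longrightarrow> D p q \<le> cone_dist Y p q"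
    and pq: "p \<in> X" "q \<in> X" and \<epsilon>: "0 < \<epsilon>"
  shows "\<exists>g\<in>carrier G. len g + D (act g p) q < wd p q + \<epsilon>"
proof -
  interpret D: Metric_space X D by (rule D)
  define \<Delta> :: "real \<times> 'y \<Rightarrow> real \<times> 'y \<Rightarrow> real" where "\<Delta> p q = (if p \<in> X \<and> q \<in> X then INF g\<in>carrier G. real (len g) + D (act g p) q else 0)" for p q
  have bdd: "bdd_below ((\<lambda>g. real (len g) + D (act g p) q) ` carrier G)" for p q
    by (rule bdd_belowI2[where m = 0]) simp
  have ne: "carrier G \<noteq> {}" using one_closed by blast
  have low: "\<Delta> p q \<le> len g + D (act g p) q" if "p \<in> X" "q \<in> X" "g \<in> carrier G" for p q g
    using cINF_lower[OF bdd that(3)] that by (simp add: \<Delta>_def)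
  have app: "\<exists>g\<in>carrier G. len g + D (act g p) q < \<Delta> p q + e"
    if "p \<in> X" "q \<in> X" "0 < e" for p q e
  proof -
    have "(INF g\<in>carrier G. real (len g) + D (act g p) q) < \<Delta> p q + e"
      using that by (simp add: \<Delta>_def)
    then show ?thesis unfolding cINF_less_iff[OF ne bdd] .
  qed
  have nonneg: "0 \<le> \<Delta> p q" for p q
  proof (cases "p \<in> X \<and> q \<in> X")
    case True
    have "0 \<le> (INF g\<in>carrier G. real (len g) + D (act g p) q)"
      by (rule cINF_greatest[OF ne]) simp
    then show ?thesis using True by (simp add: \<Delta>_def)
  qed (simp only: \<Delta>_def if_False order_refl)
  have sym_le: "\<Delta> q p \<le> \<Delta> p q" if X: "p \<in> X" "q \<in> X" for p q
  proof (rule field_le_epsilon)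
    fix e :: real assume "0 < e"
    then obtain g where g: "g \<in> carrier G" "len g + D (act g p) q < \<Delta> p q + e"
      using app[OF X] by blast
    have "D (act (inv g) q) p = D q (act g p)"
      using inv[of g "act (inv g) q" p] g X by simp
    also have "\<dots> = D (act g p) q" by (rule D.commute)
    finally have "D (act (inv g) q) p = D (act g p) q" .
    then show "\<Delta> q p \<le> \<Delta> p q + e" using low[of q p "inv g"] g X by simp
  qed
  have "Metric_space X \<Delta>"
  proof
    fix p q w
    show "0 \<le> \<Delta> p q" by (rule nonneg)
    show "\<Delta> p q = \<Delta> q p"
      using sym_le[of p q] sym_le[of q p] by (cases "p \<in> X \<and> q \<in> X") (auto simp: \<Delta>_def)
    show "\<Delta> p q = 0 \<longleftrightarrow> p = q" if pq: "p \<in> X" "q \<in> X"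
    proof
      assume "p = q"
      then show "\<Delta> p q = 0" using low[OF pq, of \<one>] nonneg[of p q] pq by simp
    next
      assume 0: "\<Delta> p q = 0"
      have "D p q \<le> 0 + e" if e: "0 < e" for e
      proof -
        obtain g where g: "g \<in> carrier G" "len g + D (act g p) q < min 1 e"
          using app[OF pq, of "min 1 e"] 0 e by auto
        then have "len g < 1" using D.nonneg[of "act g p" q] by linarith
        then have "g = \<one>" using word_length_eq_0 g by simp
        then show ?thesis using g pq by simp
      qed
      then have "D p q \<le> 0" by (rule field_le_epsilon)
      then show "p = q" using D.nonneg[of p q] D.zero[OF pq] by simp
    qed
    show "\<Delta> p w \<le> \<Delta> p q + \<Delta> q w" if X: "p \<in> X" "q \<in> X" "w \<in> X"
    proof (rule field_le_epsilon)
      fix e :: real assume e: "0 < e"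
      obtain g where g: "g \<in> carrier G" "len g + D (act g p) q < \<Delta> p q + e / 2"
        using app[OF X(1,2), of "e / 2"] e by auto
      obtain h where h: "h \<in> carrier G" "len h + D (act h q) w < \<Delta> q w + e / 2"
        using app[OF X(2,3), of "e / 2"] e by auto
      have "D (act (h \<otimes> g) p) w \<le> D (act g p) q + D (act h q) w"
        using D.triangle[of "act h (act g p)" "act h q" w] inv[of h "act g p" q] g h X
        by (simp add: act_mult)
      then show "\<Delta> p w \<le> \<Delta> p q + \<Delta> q w + e"
        using low[of p w "h \<otimes> g"] word_length_mult[of h g] g h X by simp
    qed
  qed
  moreover have "\<forall>p\<in>X. \<forall>q\<in>X. \<Delta> p q \<le> cone_dist Y p q"
  proof (intro ballI)
    fix p q assume "p \<in> X" "q \<in> X"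
    then show "\<Delta> p q \<le> cone_dist Y p q"
      using low[of p q \<one>] le[of p q] by simp
  qed
  moreover have "\<forall>p\<in>X. \<forall>s\<in>S. \<Delta> p (act s p) \<le> 1"
  proof (intro ballI)
    fix p s assume "p \<in> X" "s \<in> S"
    then show "\<Delta> p (act s p) \<le> 1"
      using low[of p "act s p" s] letters_carrier[of s] word_length_letter[of s] by simp
  qed
  ultimately have "warping_metric S Y \<phi> \<Delta>"
    unfolding warping_metric_def by (intro conjI)
  then have "\<Delta> p q \<le> wd p q"
    using largest_wd pq unfolding largest_warping_metric_def by simp
  then show ?thesis using app[OF pq \<epsilon>] by (meson add_right_mono less_le_trans)
qed

end


section \<open>The invariant metric of a linearisation\<close>

locale linearised_action = cone_over_action G S Y \<phi>
  for G :: "('g, 'm) monoid_scheme" (structure) and S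
    and Y :: "'y::metric_space set" and \<phi> :: "'g \<Rightarrow> 'y \<Rightarrow> 'y" +
  fixes \<pi> :: "'g \<Rightarrow> 'e1 \<Rightarrow> 'e1::banach" and f :: "'y \<Rightarrow> 'e1" and c C :: real
  assumes free: "free_action G Y \<phi>"
    and rep: "isometric_representation G \<pi>"
    and c: "0 < c" and C: "0 < C"
    and f_lower: "\<And>y y'. y \<in> Y \<Longrightarrow> y' \<in> Y \<Longrightarrow> c * dist y y' \<le> norm (f y - f y')"
    and f_upper: "\<And>y y'. y \<in> Y \<Longrightarrow> y' \<in> Y \<Longrightarrow> norm (f y - f y') \<le> C * dist y y'"
    and equivariant: "\<And>g y. g \<in> carrier G \<Longrightarrow> y \<in> Y \<Longrightarrow> f (\<phi> g y) = \<pi> g (f y)"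
begin

definition radius :: real where "radius = (SUP y\<in>Y. norm (f y))"

text \<open>Normalises the pulled-back norm so that it does not exceed the cone metric.\<close>

definition scale :: real where "scale = 1 / ((1 + radius) / diameter Y + C)"

definition lin_dist :: "real \<times> 'y \<Rightarrow> real \<times> 'y \<Rightarrow> real" where
  "lin_dist p q =
     scale * (\<bar>fst p - fst q\<bar> + norm (fst p *\<^sub>R f (snd p) - fst q *\<^sub>R f (snd q)))"

lemma dist_le_diameter: "y \<in> Y \<Longrightarrow> y' \<in> Y \<Longrightarrow> dist y y' \<le> diameter Y"
  using diameter_bounded_bound[OF compact_imp_bounded[OF compact]] .

lemma norm_f_le_radius:
  assumes "y \<in> Y" shows "norm (f y) \<le> radius"
  unfolding radius_def
proof (rule cSUP_upper[OF assms])
  show "bdd_above ((\<lambda>y. norm (f y)) ` Y)"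
  proof (rule bdd_aboveI2)
    fix y' assume y': "y' \<in> Y"
    have "norm (f y') \<le> norm (f y) + norm (f y' - f y)" by norm
    also have "norm (f y' - f y) \<le> C * dist y' y" using f_upper y' assms by blast
    also have "C * dist y' y \<le> C * diameter Y"
      using dist_le_diameter y' assms C by (simp add: mult_left_mono)
    finally show "norm (f y') \<le> norm (f y) + C * diameter Y" by simp
  qed
qed

lemma radius_nonneg: "0 \<le> radius"
  using Y_nonempty norm_f_le_radius norm_ge_zero by (meson all_not_in_conv order_trans)

lemma scale_pos: "0 < scale"
  unfolding scale_def using radius_nonneg diam C by (simp add: add_nonneg_pos)

text \<open>With \<open>r\<close> the smaller height, write \<open>r f(x) - t f(y) = r (f(x) - f(y)) - (t - r) f(y)\<close>; the
  first part is the horizontal and the second the vertical term of the cone metric, since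
  \<open>f\<close> is Lipschitz and bounded.\<close>

lemma lin_dist_le_cone_dist:
  assumes "p \<in> X" "q \<in> X"
  shows "lin_dist p q \<le> cone_dist Y p q"
proof -
  have *: "lin_dist p q \<le> cone_dist Y p q" if X: "p \<in> X" "q \<in> X" and le: "fst p \<le> fst q" for p q
  proof -
    obtain r x where p: "p = (r, x)" "r > 0" "x \<in> Y" using X by (auto simp: infinite_cone_def)
    obtain t y where q: "q = (t, y)" "t > 0" "y \<in> Y" using X by (auto simp: infinite_cone_def)
    have rt: "r \<le> t" using le p q by simp
    have "norm (r *\<^sub>R f x - t *\<^sub>R f y) = norm (r *\<^sub>R (f x - f y) - (t - r) *\<^sub>R f y)"
      by (simp add: algebra_simps)
    also have "\<dots> \<le> norm (r *\<^sub>R (f x - f y)) + norm ((t - r) *\<^sub>R f y)"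
      by (rule norm_triangle_ineq4)
    also have "\<dots> = r * norm (f x - f y) + (t - r) * norm (f y)"
      using p rt by simp
    also have "\<dots> \<le> r * (C * dist x y) + (t - r) * radius"
      using p q rt f_upper norm_f_le_radius by (intro add_mono mult_left_mono) auto
    finally have a: "\<bar>r - t\<bar> + norm (r *\<^sub>R f x - t *\<^sub>R f y)
        \<le> (t - r) * (1 + radius) + C * (r * dist x y)"
      using rt by (simp add: algebra_simps)
    define Q where "Q = (1 + radius) / diameter Y"
    have Q: "0 < Q" "Q * diameter Y = 1 + radius"
      unfolding Q_def using radius_nonneg diam by auto
    have "(t - r) * (1 + radius) + C * (r * dist x y)
        \<le> (Q + C) * ((t - r) * diameter Y + r * dist x y)"
    proof -
      have "0 \<le> C * ((t - r) * diameter Y)" "0 \<le> Q * (r * dist x y)"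
        using C Q(1) diam rt p by auto
      moreover have "(Q + C) * ((t - r) * diameter Y + r * dist x y) =
          (t - r) * (Q * diameter Y) + C * ((t - r) * diameter Y)
          + Q * (r * dist x y) + C * (r * dist x y)"
        by (simp add: algebra_simps)
      ultimately show ?thesis unfolding Q(2) by linarith
    qed
    with a have "\<bar>r - t\<bar> + norm (r *\<^sub>R f x - t *\<^sub>R f y)
        \<le> (Q + C) * ((t - r) * diameter Y + r * dist x y)" by linarith
    then have "lin_dist p q \<le> scale * ((Q + C) * ((t - r) * diameter Y + r * dist x y))"
      unfolding lin_dist_def using scale_pos p q by simp
    also have "\<dots> = (t - r) * diameter Y + r * dist x y"
      unfolding scale_def Q_def[symmetric] using Q(1) C by simp
    finally show ?thesis using p q rt by (simp add: cone_dist_def min_def)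
  qed
  have comm: "lin_dist p q = lin_dist q p"
    by (simp add: lin_dist_def norm_minus_commute abs_minus_commute)
  show ?thesis
    using *[OF assms] *[OF assms(2,1)] comm cone_dist_commute[of Y p q]
    by (cases "fst p \<le> fst q") auto
qed

text \<open>The same decomposition read backwards: the horizontal term is recovered from the lower Lipschitz
  bound on \<open>f\<close> at the price of a multiple of the height difference.\<close>

lemma cone_dist_le_lin_dist:
  "\<exists>L>0. \<forall>p\<in>X. \<forall>q\<in>X. cone_dist Y p q \<le> L * lin_dist p q"
proof -
  define L where "L = (diameter Y + radius / c + 1 / c)"
  have L: "0 < L" unfolding L_def using diam c radius_nonneg by (simp add: add_pos_nonneg)
  have *: "cone_dist Y p q \<le> L / scale * lin_dist p q"
    if X: "p \<in> X" "q \<in> X" and le: "fst p \<le> fst q" for p q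
  proof -
    obtain r x where p: "p = (r, x)" "r > 0" "x \<in> Y" using X by (auto simp: infinite_cone_def)
    obtain t y where q: "q = (t, y)" "t > 0" "y \<in> Y" using X by (auto simp: infinite_cone_def)
    have rt: "r \<le> t" using le p q by simp
    define n where "n = norm (r *\<^sub>R f x - t *\<^sub>R f y)"
    have "r * norm (f x - f y) = norm (r *\<^sub>R (f x - f y))" using p by simp
    also have "\<dots> = norm ((r *\<^sub>R f x - t *\<^sub>R f y) + (t - r) *\<^sub>R f y)"
      by (simp add: algebra_simps)
    also have "\<dots> \<le> n + norm ((t - r) *\<^sub>R f y)"
      unfolding n_def by (rule norm_triangle_ineq)
    also have "\<dots> \<le> n + (t - r) * radius"
      using rt q norm_f_le_radius by (simp add: mult_left_mono)
    finally have a: "r * norm (f x - f y) \<le> n + (t - r) * radius" .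
    have "c * (r * dist x y) \<le> r * norm (f x - f y)"
      using f_lower[of x y] p q by (simp add: mult.left_commute mult_left_mono)
    with a have "c * (r * dist x y) \<le> n + (t - r) * radius" by linarith
    then have "r * dist x y \<le> (n + (t - r) * radius) / c"
      using c by (simp add: pos_le_divide_eq mult.commute)
    then have "cone_dist Y p q \<le> (t - r) * diameter Y + (n + (t - r) * radius) / c"
      using p q rt by (simp add: cone_dist_def min_def)
    also have "\<dots> = (t - r) * (diameter Y + radius / c) + n * (1 / c)"
      using c by (simp add: field_simps)
    also have "\<dots> \<le> (t - r) * L + n * L"
    proof -
      have "diameter Y + radius / c \<le> L" "1 / c \<le> L"
        unfolding L_def using c diam radius_nonneg by simp_all
      then show ?thesis using rt n_def by (intro add_mono[OF mult_left_mono mult_left_mono]) auto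
    qed
    also have "\<dots> = L / scale * lin_dist p q"
      using scale_pos p q rt by (simp add: lin_dist_def n_def algebra_simps)
    finally show ?thesis .
  qed
  have comm: "lin_dist p q = lin_dist q p" for p q
    by (simp add: lin_dist_def norm_minus_commute abs_minus_commute)
  have "cone_dist Y p q \<le> L / scale * lin_dist p q" if "p \<in> X" "q \<in> X" for p q
    using *[OF that] *[OF that(2,1)] comm cone_dist_commute[of Y p q]
    by (cases "fst p \<le> fst q") auto
  then show ?thesis using L scale_pos by (intro exI[of _ "L / scale"]) auto
qed

sublocale ld: Metric_space X lin_dist
proof
  fix p q w :: "real \<times> 'y"
  show "0 \<le> lin_dist p q" using scale_pos by (simp add: lin_dist_def)
  show "lin_dist p q = lin_dist q p"
    by (simp add: lin_dist_def norm_minus_commute abs_minus_commute)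
  show "lin_dist p q = 0 \<longleftrightarrow> p = q" if pq: "p \<in> X" "q \<in> X"
  proof
    assume 0: "lin_dist p q = 0"
    obtain L where "cone_dist Y p q \<le> L * lin_dist p q"
      using cone_dist_le_lin_dist pq by blast
    then have "cone_dist Y p q = 0" using 0 cone_dist_nonneg[OF diam pq] by simp
    then show "p = q" using cone_dist_eq_0[OF diam pq] by simp
  qed (simp add: lin_dist_def)
  show "lin_dist p w \<le> lin_dist p q + lin_dist q w"
  proof -
    have "norm (fst p *\<^sub>R f (snd p) - fst w *\<^sub>R f (snd w))
        \<le> norm (fst p *\<^sub>R f (snd p) - fst q *\<^sub>R f (snd q))
          + norm (fst q *\<^sub>R f (snd q) - fst w *\<^sub>R f (snd w))"
      unfolding dist_norm[symmetric] by (rule dist_triangle)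
    moreover have "\<bar>fst p - fst w\<bar> \<le> \<bar>fst p - fst q\<bar> + \<bar>fst q - fst w\<bar>" by simp
    ultimately show ?thesis
      using scale_pos by (simp add: lin_dist_def flip: distrib_left)
  qed
qed

lemma \<pi>_linear: "g \<in> carrier G \<Longrightarrow> linear (\<pi> g)"
  and norm_\<pi>: "g \<in> carrier G \<Longrightarrow> norm (\<pi> g v) = norm v"
  using rep by (auto simp: isometric_representation_def)

lemma lin_dist_act [simp]:
  assumes "g \<in> carrier G" "p \<in> X" "q \<in> X"
  shows "lin_dist (act g p) (act g q) = lin_dist p q"
proof -
  have "snd p \<in> Y" "snd q \<in> Y" using assms by (auto simp: infinite_cone_def)
  then have "norm (fst p *\<^sub>R f (\<phi> g (snd p)) - fst q *\<^sub>R f (\<phi> g (snd q)))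
      = norm (\<pi> g (fst p *\<^sub>R f (snd p) - fst q *\<^sub>R f (snd q)))"
    using \<pi>_linear[OF assms(1)] assms by (simp add: equivariant linear_diff linear_scale)
  then show ?thesis using norm_\<pi> assms by (simp add: lin_dist_def cone_action_def)
qed

lemma exists_sheet:
  assumes "p \<in> X" "q \<in> X"
  shows "\<exists>g\<in>carrier G. len g + lin_dist (act g p) q < wd p q + 1"
  using unwarped_lt_wd[OF ld.Metric_space_axioms lin_dist_act lin_dist_le_cone_dist assms] by simp

text \<open>For a single \<open>g\<close> the continuous function \<open>dist y (\<phi> g y)\<close> attains its infimum on the compact
  space, and freeness makes it positive.\<close>

lemma uniformly_free:
  assumes "finite B" "B \<subseteq> carrier G"
  shows "\<exists>\<epsilon>>0. \<forall>g\<in>B. g \<noteq> \<one> \<longrightarrow> (\<forall>y\<in>Y. \<epsilon> \<le> norm (f y - f (\<phi> g y)))"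
  using assms
proof (induction B)
  case empty
  show ?case by (intro exI[of _ 1]) simp
next
  case (insert g B)
  then obtain \<epsilon> where \<epsilon>: "\<epsilon> > 0" "\<And>h y. h \<in> B \<Longrightarrow> h \<noteq> \<one> \<Longrightarrow> y \<in> Y \<Longrightarrow> \<epsilon> \<le> norm (f y - f (\<phi> h y))"
    by auto
  show ?case
  proof (cases "g = \<one>")
    case True
    then show ?thesis using \<epsilon> by blast
  next
    case False
    have g: "g \<in> carrier G" using insert.prems by simp
    have "continuous_on Y (\<phi> g)" using action g by (simp add: continuous_action_def)
    then have "continuous_on Y (\<lambda>y. dist y (\<phi> g y))" by (intro continuous_intros)
    from continuous_attains_inf[OF compact Y_nonempty this]
    obtain y0 where y0: "y0 \<in> Y" "\<And>y. y \<in> Y \<Longrightarrow> dist y0 (\<phi> g y0) \<le> dist y (\<phi> g y)" by blast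
    define \<epsilon>' where "\<epsilon>' = c * dist y0 (\<phi> g y0)"
    have "\<phi> g y0 \<noteq> y0" using free y0(1) g False by (auto simp: free_action_def)
    then have "\<epsilon>' > 0" using c by (simp add: \<epsilon>'_def)
    moreover have "\<epsilon>' \<le> norm (f y - f (\<phi> g y))" if "y \<in> Y" for y
    proof -
      have "\<epsilon>' \<le> c * dist y (\<phi> g y)" unfolding \<epsilon>'_def using y0(2)[OF that] c by simp
      also have "\<dots> \<le> norm (f y - f (\<phi> g y))" using f_lower that action_closed[OF g that] by blast
      finally show ?thesis .
    qed
    ultimately show ?thesis
      using \<epsilon> by (intro exI[of _ "min \<epsilon> \<epsilon>'"]) (auto simp: min.coboundedI1 min.coboundedI2)
  qed
qed

text \<open>At height \<open>r\<close> the invariant distance between \<open>g p\<close> and \<open>h p\<close> is \<open>r\<close> times a quantity bounded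
  below by uniform freeness, unless \<open>g = h\<close>.\<close>

lemma sheets_separate:
  "\<exists>R::real. \<forall>p\<in>X. R < fst p \<longrightarrow> (\<forall>g\<in>carrier G. \<forall>h\<in>carrier G.
     len g + len h \<le> m \<longrightarrow> lin_dist (act g p) (act h p) \<le> real m \<longrightarrow> g = h)"
proof -
  obtain \<epsilon> where \<epsilon>: "\<epsilon> > 0"
    "\<And>g y. g \<in> word_ball G S m \<Longrightarrow> g \<noteq> \<one> \<Longrightarrow> y \<in> Y \<Longrightarrow> \<epsilon> \<le> norm (f y - f (\<phi> g y))"
    using uniformly_free[OF finite_word_ball word_ball_carrier] by blast
  show ?thesis
  proof (intro exI[of _ "m / (scale * \<epsilon>)"] ballI impI, rule ccontr)
    fix p g h
    assume p: "p \<in> X" "m / (scale * \<epsilon>) < fst p" and g: "g \<in> carrier G" and h: "h \<in> carrier G"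
      and le: "len g + len h \<le> m" and d: "lin_dist (act g p) (act h p) \<le> real m" and ne: "g \<noteq> h"
    define k where "k = inv g \<otimes> h"
    have k: "k \<in> carrier G" "h = g \<otimes> k"
      using g h by (simp_all add: k_def flip: m_assoc)
    have "k \<noteq> \<one>" using k ne g by auto
    moreover have "k \<in> word_ball G S m"
      using word_length_mult[of "inv g" h] g h le k(1) by (simp add: k_def flip: word_length_le_iff)
    moreover have y: "snd p \<in> Y" "fst p > 0" using p by (auto simp: infinite_cone_def)
    ultimately have "\<epsilon> \<le> norm (f (snd p) - f (\<phi> k (snd p)))" using \<epsilon>(2) by blast
    then have "scale * (fst p * \<epsilon>) \<le> scale * (fst p * norm (f (snd p) - f (\<phi> k (snd p))))"
      using scale_pos y by simp
    also have "\<dots> = lin_dist p (act k p)"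
      using y by (simp add: lin_dist_def cone_action_def flip: scaleR_diff_right)
    also have "\<dots> = lin_dist (act g p) (act h p)" using p g k by (simp add: act_mult)
    also have "\<dots> \<le> m" by (rule d)
    finally show False using p(2) scale_pos \<epsilon>(1) by (simp add: field_simps)
  qed
qed

lemma mbounded_bottom: "wd.mbounded {p \<in> X. fst p \<le> R}"
proof -
  obtain y0 where y0: "y0 \<in> Y" using Y_nonempty by blast
  have "{p \<in> X. fst p \<le> R} \<subseteq> wd.mcball (1, y0) ((1 + R) * diameter Y + diameter Y)"
  proof
    fix p assume "p \<in> {p \<in> X. fst p \<le> R}"
    then obtain r y where p: "p = (r, y)" "r > 0" "y \<in> Y" "r \<le> R" "p \<in> X"
      by (auto simp: infinite_cone_def)
    have X: "(1, y0) \<in> X" using y0 by (simp add: infinite_cone_def)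
    have "wd (1, y0) p \<le> \<bar>1 - r\<bar> * diameter Y + min 1 r * dist y0 y"
      using wd_le_cone_dist[OF X p(5)] p by (simp add: cone_dist_def)
    also have "\<dots> \<le> (1 + R) * diameter Y + 1 * diameter Y"
      using p diam y0 dist_le_diameter by (intro add_mono mult_mono) auto
    finally show "p \<in> wd.mcball (1, y0) ((1 + R) * diameter Y + diameter Y)"
      using X p by simp
  qed
  then show ?thesis unfolding wd.mbounded_def by blast
qed

end


section \<open>Sums of norms and control functions\<close>

text \<open>Coarse estimates only see the \<open>\<ell>\<^sup>q\<close>-norm up to a constant, so comparison with the maximum and
  with the sum of the three norms replaces any use of the exponent.  The factor \<open>3\<close> is crude but
  is uniform in the exponent: \<open>3 \<le> 3\<^sup>p\<close>.\<close>

lemma lq_sum_norm_bounds: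
  fixes u :: "'e1::real_normed_vector" and v :: "'e2::real_normed_vector"
  assumes "1 \<le> q"
  shows "\<bar>t\<bar> \<le> lq_sum_norm q (t, u, v)" "norm u \<le> lq_sum_norm q (t, u, v)"
    "norm v \<le> lq_sum_norm q (t, u, v)"
    "lq_sum_norm q (t, u, v) \<le> 3 * (\<bar>t\<bar> + norm u + norm v)"
proof -
  let ?N = "lq_sum_norm q (t, u, v)"
  have "\<bar>t\<bar> \<le> ?N \<and> norm u \<le> ?N \<and> norm v \<le> ?N \<and> ?N \<le> 3 * (\<bar>t\<bar> + norm u + norm v)"
  proof (cases "q = \<infinity>")
    case True
    then show ?thesis by (auto simp: lq_sum_norm_def)
  next
    case False
    define p where "p = real_of_ereal q"
    have p: "1 \<le> p" using assms False by (cases q) (auto simp: p_def)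
    define s where "s = \<bar>t\<bar> powr p + norm u powr p + norm v powr p"
    have N: "?N = s powr (1 / p)" using False by (simp add: lq_sum_norm_def p_def s_def)
    have low: "a \<le> ?N" if "0 \<le> a" "a powr p \<le> s" for a
    proof -
      have "a = (a powr p) powr (1 / p)" using that p by (simp add: powr_powr)
      also have "\<dots> \<le> ?N" unfolding N using that p by (intro powr_mono2) auto
      finally show ?thesis .
    qed
    define M where "M = \<bar>t\<bar> + norm u + norm v"
    have "s \<le> M powr p + M powr p + M powr p"
      unfolding s_def M_def using p by (intro add_mono powr_mono2) auto
    also have "\<dots> = 3 powr 1 * M powr p" by simp
    also have "\<dots> \<le> 3 powr p * M powr p"
      using p by (intro mult_right_mono powr_mono) auto
    also have "\<dots> = (3 * M) powr p" by (subst powr_mult) (simp_all add: M_def)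
    finally have "?N \<le> ((3 * M) powr p) powr (1 / p)"
      unfolding N using p by (intro powr_mono2) (auto simp: s_def)
    also have "\<dots> = 3 * M" using p by (simp add: powr_powr M_def)
    finally show ?thesis using low by (simp add: M_def s_def)
  qed
  then show "\<bar>t\<bar> \<le> ?N" "norm u \<le> ?N" "norm v \<le> ?N" "?N \<le> 3 * (\<bar>t\<bar> + norm u + norm v)"
    by auto
qed

text \<open>A generalised inverse of \<open>\<Psi>\<close>, the infimum of the arguments at which \<open>\<Psi>\<close> has reached \<open>t\<close>,
  turns an upper bound for \<open>t\<close> in terms of \<open>a\<close> into a lower bound for \<open>a\<close>.  The growth condition
  keeps the infimum from being taken over the empty set.\<close>

lemma control_function_inverse:
  assumes mono: "mono_on {0..} \<Psi>" and ge: "\<And>a. 0 \<le> a \<Longrightarrow> a \<le> \<Psi> a"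
  shows "\<exists>\<rho>. control_function \<rho> \<and> (\<forall>t\<ge>0. \<forall>a\<ge>0. t \<le> \<Psi> a \<longrightarrow> \<rho> t \<le> a)"
proof -
  define A where "A t = {a. 0 \<le> a \<and> t \<le> \<Psi> a}" for t
  define \<rho> where "\<rho> t = Inf (A t)" for t
  have ne: "A t \<noteq> {}" for t
    using ge[of "\<bar>t\<bar>"] by (auto simp: A_def intro!: exI[of _ "\<bar>t\<bar>"])
  have bdd: "bdd_below (A t)" for t by (rule bdd_belowI[of _ 0]) (simp add: A_def)
  have "\<rho> ` {0..} \<subseteq> {0..}"
    unfolding \<rho>_def by (auto intro!: cInf_greatest[OF ne]) (simp add: A_def)
  moreover have "mono_on {0..} \<rho>"
    unfolding \<rho>_def by (intro mono_onI cInf_superset_mono ne bdd) (auto simp: A_def)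
  moreover have "\<not> bdd_above (\<rho> ` {0..})"
  proof
    assume "bdd_above (\<rho> ` {0..})"
    then obtain B where B: "\<And>t. 0 \<le> t \<Longrightarrow> \<rho> t \<le> B" by (auto simp: bdd_above_def)
    define b where "b = \<bar>B\<bar> + 1"
    define t where "t = \<Psi> b + 1"
    have t: "0 \<le> t" using ge[of b] by (simp add: t_def b_def)
    have "b \<le> a" if "a \<in> A t" for a
    proof (rule ccontr)
      assume "\<not> b \<le> a"
      then have "\<Psi> a \<le> \<Psi> b" using that by (intro mono_onD[OF mono]) (auto simp: A_def b_def)
      then show False using that by (simp add: A_def t_def)
    qed
    then have "b \<le> \<rho> t" unfolding \<rho>_def by (rule cInf_greatest[OF ne])
    then show False using B[OF t] by (simp add: b_def)
  qed
  moreover have "\<rho> t \<le> a" if "0 \<le> a" "t \<le> \<Psi> a" for t a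
    unfolding \<rho>_def using that by (intro cInf_lower bdd) (simp add: A_def)
  ultimately show ?thesis
    unfolding control_function_def by (intro exI[of _ \<rho>] conjI allI impI)
qed


section \<open>The fibred coarse embedding\<close>

locale proper_linearised_action = linearised_action G S Y \<phi> \<pi> f c C
  for G :: "('g, 'm) monoid_scheme" (structure) and S
    and Y :: "'y::metric_space set" and \<phi> :: "'g \<Rightarrow> 'y \<Rightarrow> 'y"
    and \<pi> :: "'g \<Rightarrow> 'e1 \<Rightarrow> 'e1::banach" and f :: "'y \<Rightarrow> 'e1" and c C :: real +
  fixes \<alpha> :: "'g \<Rightarrow> 'e2 \<Rightarrow> 'e2::banach"
  assumes affine: "isometric_affine_action G \<alpha>"
    and proper: "\<And>v w r. finite {g \<in> carrier G. \<alpha> g v \<in> ball w r}"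
begin

definition twist :: "'g \<Rightarrow> real \<times> 'e1 \<times> 'e2 \<Rightarrow> real \<times> 'e1 \<times> 'e2" where
  "twist g e = (fst e, \<pi> g (fst (snd e)), \<alpha> g (snd (snd e)))"

definition cone_section :: "real \<times> 'y \<Rightarrow> real \<times> 'e1 \<times> 'e2" where
  "cone_section p = (fst p, fst p *\<^sub>R f (snd p), 0)"

lemma \<pi>_action: "group_action G UNIV \<pi>"
  using rep by (simp add: isometric_representation_def)

lemma \<alpha>_action: "group_action G UNIV \<alpha>"
  using affine by (simp add: isometric_affine_action_def)

lemma \<alpha>_isometry: "g \<in> carrier G \<Longrightarrow> norm (\<alpha> g u - \<alpha> g v) = norm (u - v)"
  using affine by (simp add: isometric_affine_action_def dist_norm)

lemma action_mult:
  assumes "g \<in> carrier G" "h \<in> carrier G"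
  shows "\<pi> (g \<otimes> h) u = \<pi> g (\<pi> h u)" "\<alpha> (g \<otimes> h) v = \<alpha> g (\<alpha> h v)"
  using group_action.composition_rule[OF \<pi>_action] group_action.composition_rule[OF \<alpha>_action]
    assms by auto

lemma action_one: "\<pi> \<one> u = u" "\<alpha> \<one> v = v"
  by (simp_all flip: group_action.id_eq_one[OF \<pi>_action] group_action.id_eq_one[OF \<alpha>_action])

lemma twist_mult: "g \<in> carrier G \<Longrightarrow> h \<in> carrier G \<Longrightarrow> twist (g \<otimes> h) e = twist g (twist h e)"
  by (simp add: twist_def action_mult)

lemma twist_one: "twist \<one> e = e"
  by (simp add: twist_def action_one)

lemma twist_inv [simp]:
  "g \<in> carrier G \<Longrightarrow> twist (inv g) (twist g e) = e"
  "g \<in> carrier G \<Longrightarrow> twist g (twist (inv g) e) = e"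
  by (simp_all add: twist_one flip: twist_mult)

lemma bij_twist: "g \<in> carrier G \<Longrightarrow> bij (twist g)"
  by (rule o_bij[of "twist (inv g)"]) (auto simp: fun_eq_iff)

lemma lq_sum_norm_twist:
  assumes "g \<in> carrier G"
  shows "lq_sum_norm q (twist g e - twist g e') = lq_sum_norm q (e - e')"
proof -
  have "norm (\<pi> g u - \<pi> g u') = norm (u - u')" for u u'
    using norm_\<pi>[OF assms, of "u - u'"] \<pi>_linear[OF assms] by (simp add: linear_diff)
  then show ?thesis
    using \<alpha>_isometry[OF assms] by (simp add: twist_def lq_sum_norm_def minus_prod_def)
qed

lemma isometry_twist:
  "g \<in> carrier G \<Longrightarrow>
     isometry_onto UNIV (norm_dist (lq_sum_norm q)) UNIV (norm_dist (lq_sum_norm q)) (twist g)"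
  using bij_twist lq_sum_norm_twist by (auto simp: isometry_onto_def norm_dist_def)

lemma twist_cone_section:
  assumes "g \<in> carrier G" "p \<in> X"
  shows "twist g (cone_section p) = (fst p, fst p *\<^sub>R f (snd (act g p)), \<alpha> g 0)"
proof -
  have "snd p \<in> Y" using assms by (auto simp: infinite_cone_def)
  then show ?thesis using \<pi>_linear[OF assms(1)] assms
    by (simp add: twist_def cone_section_def cone_action_def equivariant linear_scale)
qed

text \<open>The first two components of the difference make up the invariant distance between \<open>g p\<close> and
  \<open>p'\<close>, up to the normalisation, and the third is the displacement of the origin.\<close>

lemma twisted_section_bounds:
  fixes q :: ereal
  assumes q: "1 \<le> q" and g: "g \<in> carrier G" and p: "p \<in> X" "p' \<in> X"
  defines "a \<equiv> lq_sum_norm q (twist g (cone_section p) - cone_section p')"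
  shows "lin_dist (act g p) p' \<le> 2 * scale * a" "norm (\<alpha> g 0) \<le> a"
    "a \<le> 3 * (lin_dist (act g p) p' / scale + norm (\<alpha> g 0))" "0 \<le> a"
proof -
  define s where "s = \<bar>fst p - fst p'\<bar>"
  define n where "n = norm (fst p *\<^sub>R f (snd (act g p)) - fst p' *\<^sub>R f (snd p'))"
  have a: "a = lq_sum_norm q (fst p - fst p', fst p *\<^sub>R f (snd (act g p)) - fst p' *\<^sub>R f (snd p'), \<alpha> g 0)"
    unfolding a_def by (simp add: twist_cone_section[OF g p(1)]) (simp add: cone_section_def)
  have d: "lin_dist (act g p) p' = scale * (s + n)"
    by (simp add: lin_dist_def s_def n_def cone_action_def)
  have b: "s \<le> a" "n \<le> a" "norm (\<alpha> g 0) \<le> a" "a \<le> 3 * (s + n + norm (\<alpha> g 0))"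
    unfolding a s_def n_def by (rule lq_sum_norm_bounds[OF q])+
  show "lin_dist (act g p) p' \<le> 2 * scale * a"
    using b(1,2) scale_pos by (simp add: d mult.assoc mult.left_commute[of 2])
  show "norm (\<alpha> g 0) \<le> a" by (rule b)
  show "a \<le> 3 * (lin_dist (act g p) p' / scale + norm (\<alpha> g 0))"
    using b(4) scale_pos by (simp add: d)
  show "0 \<le> a" using b(3) norm_ge_zero order_trans by blast
qed

text \<open>Since letters act isometrically, prefixing a letter to a word adds at most the displacement
  of the origin by that letter.\<close>

lemma displacement_bound: "\<exists>V::real. 0 \<le> V \<and> (\<forall>g\<in>carrier G. norm (\<alpha> g 0) \<le> V * len g)"
proof -
  define V where "V = (\<Sum>s\<in>letters. norm (\<alpha> s 0))"
  have V: "0 \<le> V" unfolding V_def by (rule sum_nonneg) simp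
  have "norm (\<alpha> g 0) \<le> V * len g" if "g \<in> carrier G" for g
  proof (rule le_word_length[where \<omega> = "\<lambda>g. norm (\<alpha> g 0)", OF _ _ V that])
    fix s h assume s: "s \<in> letters" and h: "h \<in> carrier G"
    note sc = letters_carrier[OF s]
    have "norm (\<alpha> s 0) \<le> V"
      unfolding V_def by (rule member_le_sum[OF s _ finite_letters]) simp
    moreover have "norm (\<alpha> (s \<otimes> h) 0) \<le> norm (\<alpha> s (\<alpha> h 0) - \<alpha> s 0) + norm (\<alpha> s 0)"
      using action_mult(2)[OF sc h] norm_triangle_sub[of "\<alpha> s (\<alpha> h 0)" "\<alpha> s 0"] by simp
    ultimately show "norm (\<alpha> (s \<otimes> h) 0) \<le> V + norm (\<alpha> h 0)"
      using \<alpha>_isometry[OF sc, of "\<alpha> h 0" 0] by simp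
  qed (simp add: action_one)
  then show ?thesis using V by blast
qed

text \<open>Properness, applied to the orbit of the origin: only finitely many elements displace
  it by at most \<open>a\<close>, and \<open>\<Lambda> a\<close> is the maximum of their lengths.\<close>

lemma length_bound:
  "\<exists>\<Lambda>. mono_on {0..} \<Lambda> \<and> (\<forall>a\<ge>0. 0 \<le> \<Lambda> a) \<and>
     (\<forall>a\<ge>0. \<forall>g\<in>carrier G. norm (\<alpha> g 0) \<le> a \<longrightarrow> real (len g) \<le> \<Lambda> a)"
proof -
  define B where "B a = (\<lambda>g. real (len g)) ` {g \<in> carrier G. norm (\<alpha> g 0) \<le> a}" for a
  have fin: "finite (B a)" for a
    unfolding B_def
    by (intro finite_imageI finite_subset[OF _ proper[of 0 0 "a + 1"]]) auto
  have 0: "0 \<in> B a" if "0 \<le> a" for a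
    using that by (auto simp: B_def action_one intro!: image_eqI[of _ _ \<one>])
  show ?thesis
  proof (intro exI[of _ "\<lambda>a. Max (B a)"] conjI allI impI ballI)
    show "mono_on {0..} (\<lambda>a. Max (B a))"
    proof (rule mono_onI)
      fix a b :: real assume "a \<in> {0..}" "b \<in> {0..}" "a \<le> b"
      then show "Max (B a) \<le> Max (B b)"
        using 0[of a] fin by (intro Max_mono) (auto simp: B_def)
    qed
    show "0 \<le> Max (B a)" if "0 \<le> a" for a using Max_ge[OF fin 0[OF that]] .
    show "real (len g) \<le> Max (B a)" if "g \<in> carrier G" "norm (\<alpha> g 0) \<le> a" for a g
      by (rule Max_ge[OF fin]) (use that in \<open>auto simp: B_def\<close>)
  qed
qed

text \<open>An element \<open>g\<close> that almost realises the warped distance splits it into a length and an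
  invariant distance; both are controlled, from above and from below, by the norm of the twisted
  difference of sections.  One pair of control functions serves every pair of points, and hence every
  scale of the fibred embedding.\<close>

lemma control_functions:
  assumes q: "1 \<le> q"
  shows "\<exists>\<rho>m \<rho>p. control_function \<rho>m \<and> control_function \<rho>p \<and>
    (\<forall>p\<in>X. \<forall>p'\<in>X. \<forall>g\<in>carrier G. len g + lin_dist (act g p) p' < wd p p' + 1 \<longrightarrow>
      \<rho>m (wd p p') \<le> lq_sum_norm q (twist g (cone_section p) - cone_section p') \<and>
      lq_sum_norm q (twist g (cone_section p) - cone_section p') \<le> \<rho>p (wd p p'))"
proof -
  obtain L where L: "0 < L" "\<And>p p'. p \<in> X \<Longrightarrow> p' \<in> X \<Longrightarrow> cone_dist Y p p' \<le> L * lin_dist p p'"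
    using cone_dist_le_lin_dist by blast
  obtain V :: real where V: "0 \<le> V" "\<And>g. g \<in> carrier G \<Longrightarrow> norm (\<alpha> g 0) \<le> V * len g"
    using displacement_bound by blast
  obtain \<Lambda> where \<Lambda>: "mono_on {0..} \<Lambda>" "\<And>a. 0 \<le> a \<Longrightarrow> 0 \<le> \<Lambda> a"
    "\<And>a g. 0 \<le> a \<Longrightarrow> g \<in> carrier G \<Longrightarrow> norm (\<alpha> g 0) \<le> a \<Longrightarrow> real (len g) \<le> \<Lambda> a"
    using length_bound by blast
  define M where "M = 2 * scale * L + 1"
  have M: "1 \<le> M" using L scale_pos by (simp add: M_def)
  define \<Psi> where "\<Psi> a = \<Lambda> a + M * a" for a
  have "mono_on {0..} \<Psi>"
    unfolding \<Psi>_def using M by (intro mono_onI add_mono mono_onD[OF \<Lambda>(1)] mult_left_mono) auto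
  moreover have "a \<le> \<Psi> a" if "0 \<le> a" for a
    using \<Lambda>(2)[OF that] mult_right_mono[OF M that] by (simp add: \<Psi>_def)
  ultimately obtain \<rho>m where \<rho>m: "control_function \<rho>m"
    "\<And>t a. 0 \<le> t \<Longrightarrow> 0 \<le> a \<Longrightarrow> t \<le> \<Psi> a \<Longrightarrow> \<rho>m t \<le> a"
    using control_function_inverse[of \<Psi>] by blast
  define U where "U = 3 * (1 / scale + V)"
  have U: "0 < U" using scale_pos V by (simp add: U_def add_pos_nonneg)
  define \<rho>p where "\<rho>p t = U * (t + 1)" for t
  have \<rho>p: "control_function \<rho>p"
    unfolding control_function_def
  proof (intro conjI)
    show "\<rho>p ` {0..} \<subseteq> {0..}" using U by (auto simp: \<rho>p_def)
    show "mono_on {0..} \<rho>p" using U by (auto simp: \<rho>p_def intro!: mono_onI)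
    show "\<not> bdd_above (\<rho>p ` {0..})"
    proof
      assume "bdd_above (\<rho>p ` {0..})"
      then obtain B where B: "\<And>t. 0 \<le> t \<Longrightarrow> \<rho>p t \<le> B" by (auto simp: bdd_above_def)
      have "\<rho>p (\<bar>B\<bar> / U) = \<bar>B\<bar> + U" using U by (simp add: \<rho>p_def field_simps)
      then show False using B[of "\<bar>B\<bar> / U"] U by simp
    qed
  qed
  have "\<rho>m (wd p p') \<le> a \<and> a \<le> \<rho>p (wd p p')"
    if p: "p \<in> X" "p' \<in> X" and g: "g \<in> carrier G"
      and near: "len g + lin_dist (act g p) p' < wd p p' + 1"
      and a: "a = lq_sum_norm q (twist g (cone_section p) - cone_section p')" for p p' g a
  proof
    note b = twisted_section_bounds[OF q g p, folded a]
    have "wd p p' \<le> len g + cone_dist Y (act g p) p'" by (rule wd_le_unwarped[OF g p])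
    also have "cone_dist Y (act g p) p' \<le> L * lin_dist (act g p) p'" using L(2) g p by simp
    also have "\<dots> \<le> L * (2 * scale * a)" using b(1) L(1) by simp
    also have "\<dots> \<le> M * a" using b(4) by (simp add: M_def algebra_simps)
    also have "real (len g) \<le> \<Lambda> a" by (rule \<Lambda>(3)[OF b(4) g b(2)])
    finally have "wd p p' \<le> \<Psi> a" by (simp add: \<Psi>_def)
    then show "\<rho>m (wd p p') \<le> a" by (rule \<rho>m(2)[OF wd.nonneg b(4)])
    have "a \<le> 3 * (lin_dist (act g p) p' / scale + V * len g)"
      using b(3) V(2)[OF g] by simp
    also have "\<dots> \<le> 3 * ((wd p p' + 1) / scale + V * (wd p p' + 1))"
    proof -
      have "lin_dist (act g p) p' \<le> wd p p' + 1" "real (len g) \<le> wd p p' + 1"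
        using near ld.nonneg[of "act g p" p'] by linarith+
      then have "lin_dist (act g p) p' / scale \<le> (wd p p' + 1) / scale"
        "V * len g \<le> V * (wd p p' + 1)"
        using scale_pos V(1) by (simp_all only: divide_right_mono mult_left_mono less_imp_le)
      from add_mono[OF this] show ?thesis by (rule mult_left_mono) simp
    qed
    also have "\<dots> = \<rho>p (wd p p')" by (simp add: \<rho>p_def U_def algebra_simps add_divide_distrib)
    finally show "a \<le> \<rho>p (wd p p')" .
  qed
  then show ?thesis using \<rho>m(1) \<rho>p by blast
qed

text \<open>It remains to unfold balls.  At scale \<open>n\<close> the exceptional set is the part of the cone below
  the height at which sheets are unique for the constant \<open>4 n + 4\<close>.\<close>

theorem warped_cone_fibred_coarsely_embeds:
  fixes q :: ereal
  assumes q: "1 \<le> q"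
  shows "fibred_coarsely_embeds X wd (lq_sum_norm q :: real \<times> 'e1 \<times> 'e2 \<Rightarrow> real)"
proof -
  let ?N = "lq_sum_norm q :: real \<times> 'e1 \<times> 'e2 \<Rightarrow> real"
  let ?F = "\<lambda>_ :: real \<times> 'y. UNIV :: (real \<times> 'e1 \<times> 'e2) set"
  let ?\<delta> = "\<lambda>_ :: real \<times> 'y. norm_dist ?N"
  obtain \<rho>m \<rho>p where \<rho>: "control_function \<rho>m" "control_function \<rho>p"
    "\<And>p p' g. p \<in> X \<Longrightarrow> p' \<in> X \<Longrightarrow> g \<in> carrier G \<Longrightarrow>
      len g + lin_dist (act g p) p' < wd p p' + 1 \<Longrightarrow>
      \<rho>m (wd p p') \<le> ?N (twist g (cone_section p) - cone_section p') \<and>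
      ?N (twist g (cone_section p) - cone_section p') \<le> \<rho>p (wd p p')"
    using control_functions[OF q] by blast
  have local: "\<exists>K \<tau>. K \<subseteq> X \<and> wd.mbounded K \<and>
      (\<forall>x\<in>X - K. trivialisation ?N ?F ?\<delta> (wd.mcball x n) (\<tau> x)) \<and>
      (\<forall>x\<in>X - K. \<forall>y\<in>wd.mcball x n. \<forall>y'\<in>wd.mcball x n.
         \<rho>m (wd y y') \<le> norm_dist ?N (snd (\<tau> x (y, cone_section y))) (snd (\<tau> x (y', cone_section y'))) \<and>
         norm_dist ?N (snd (\<tau> x (y, cone_section y))) (snd (\<tau> x (y', cone_section y'))) \<le> \<rho>p (wd y y')) \<and>
      (\<forall>x\<in>X - K. \<forall>x'\<in>X - K. wd.mcball x n \<inter> wd.mcball x' n \<noteq> {} \<longrightarrow>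
         (\<exists>t. isometry_onto UNIV (norm_dist ?N) UNIV (norm_dist ?N) t \<and>
           (\<forall>y\<in>wd.mcball x n \<inter> wd.mcball x' n. \<forall>e.
              \<tau> x (inv_into (Sigma (wd.mcball x' n) ?F) (\<tau> x') (y, e)) = (y, t e))))"
    for n :: nat
  proof -
    \<comment> \<open>Comparing two points of a ball uses two sheets, of length and error below \<open>n + 1\<close>, and one element
      of length and error below \<open>2 n + 1\<close>; comparing transitions uses four sheets.  The constant
      \<open>4 n + 4\<close> covers both.\<close>
    obtain R :: real where R: "\<And>p g h. p \<in> X \<Longrightarrow> R < fst p \<Longrightarrow> g \<in> carrier G \<Longrightarrow> h \<in> carrier G \<Longrightarrow>
        len g + len h \<le> 4 * n + 4 \<Longrightarrow> lin_dist (act g p) (act h p) \<le> real (4 * n + 4) \<Longrightarrow> g = h"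
      using sheets_separate[of "4 * n + 4"] by metis
    define K where "K = {p \<in> X. fst p \<le> R}"
    define sheet where "sheet x y =
      (SOME g. g \<in> carrier G \<and> len g + lin_dist (act g x) y < n + 1)" for x y
    define \<tau> where "\<tau> x = (\<lambda>(y, e). (y, twist (inv (sheet x y)) e))" for x
    have sheet: "sheet x y \<in> carrier G" "len (sheet x y) \<le> n"
        "len (sheet x y) + lin_dist (act (sheet x y) x) y < n + 1" "y \<in> X" "x \<in> X"
      if y: "y \<in> wd.mcball x n" for x y
    proof -
      have X: "x \<in> X" "y \<in> X" "wd x y \<le> n" using y by auto
      obtain g where "g \<in> carrier G" "len g + lin_dist (act g x) y < wd x y + 1"
        using exists_sheet[OF X(1,2)] by blast
      then have "\<exists>g. g \<in> carrier G \<and> len g + lin_dist (act g x) y < n + 1"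
        using X(3) by force
      from someI_ex[OF this] have s: "sheet x y \<in> carrier G"
        "len (sheet x y) + lin_dist (act (sheet x y) x) y < n + 1"
        by (simp_all add: sheet_def)
      then have "real (len (sheet x y)) < n + 1"
        using ld.nonneg[of "act (sheet x y) x" y] by linarith
      with s X show "sheet x y \<in> carrier G" "len (sheet x y) \<le> n"
        "len (sheet x y) + lin_dist (act (sheet x y) x) y < n + 1" "y \<in> X" "x \<in> X"
        by simp_all
    qed
    have unique: "g = h" if "x \<in> X - K" "g \<in> carrier G" "h \<in> carrier G"
      "len g + len h \<le> 4 * n + 4" "lin_dist (act g x) (act h x) \<le> real (4 * n + 4)" for x g h
      using R[of x g h] that by (simp add: K_def not_le)
    have triv: "trivialisation ?N ?F ?\<delta> (wd.mcball x n) (\<tau> x)" if "x \<in> X - K" for x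
      unfolding trivialisation_def
    proof (intro ballI conjI)
      fix y assume "y \<in> wd.mcball x n"
      then have i: "inv (sheet x y) \<in> carrier G" using sheet(1) by simp
      show "isometry_onto UNIV (norm_dist ?N) UNIV (norm_dist ?N) (\<lambda>u. snd (\<tau> x (y, u)))"
        using isometry_twist[OF i] by (simp add: \<tau>_def)
      have "\<tau> x ` ({y} \<times> UNIV) = {y} \<times> range (twist (inv (sheet x y)))"
        by (force simp: \<tau>_def)
      then show "\<tau> x ` ({y} \<times> UNIV) = {y} \<times> UNIV"
        using bij_is_surj[OF bij_twist[OF i]] by simp
    qed
    have control: "\<rho>m (wd y y') \<le> a \<and> a \<le> \<rho>p (wd y y')"
      if x: "x \<in> X - K" and y: "y \<in> wd.mcball x n" and y': "y' \<in> wd.mcball x n"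
        and a: "a = norm_dist ?N (snd (\<tau> x (y, cone_section y))) (snd (\<tau> x (y', cone_section y')))"
      for x y y' a
    proof -
      let ?g = "sheet x y" and ?g' = "sheet x y'"
      note s = sheet[OF y] and s' = sheet[OF y']
      obtain h where h: "h \<in> carrier G" "len h + lin_dist (act h y) y' < wd y y' + 1"
        using exists_sheet[OF s(4) s'(4)] by blast
      have "wd y y' \<le> wd x y + wd x y'"
        using wd.triangle[of y x y'] s s' by (simp add: wd.commute)
      then have "wd y y' \<le> 2 * n" using y y' by simp
      then have h2: "len h + lin_dist (act h y) y' < 2 * n + 1" using h by simp
      \<comment> \<open>Both elements carry \<open>x\<close> near \<open>y'\<close>, one of them by way of \<open>y\<close>.\<close>
      have "h \<otimes> ?g = ?g'"
      proof (rule unique[OF x])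
        have "real (len h) < 2 * n + 1" using h2 ld.nonneg[of "act h y" y'] by linarith
        then show "len (h \<otimes> ?g) + len ?g' \<le> 4 * n + 4"
          using word_length_mult[of h ?g] h s s' by simp
        have "lin_dist (act (h \<otimes> ?g) x) (act ?g' x)
            \<le> lin_dist (act h (act ?g x)) (act h y) + lin_dist (act h y) (act ?g' x)"
          using ld.triangle[of "act h (act ?g x)" "act h y" "act ?g' x"] h s s'
          by (simp add: act_mult)
        also have "\<dots> \<le> lin_dist (act ?g x) y + (lin_dist (act h y) y' + lin_dist (act ?g' x) y')"
          using ld.triangle[of "act h y" y' "act ?g' x"] h s s'
          by (simp add: ld.commute[of y'])
        finally show "lin_dist (act (h \<otimes> ?g) x) (act ?g' x) \<le> real (4 * n + 4)"
          using s(3) s'(3) h2 by simp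
      qed (use h s s' in auto)
      then have "?g' \<otimes> inv ?g = h" using h s by (simp add: m_assoc flip: \<open>h \<otimes> ?g = ?g'\<close>)
      then have "twist ?g' (twist (inv ?g) (cone_section y)) = twist h (cone_section y)"
        using s s' by (simp flip: twist_mult)
      \<comment> \<open>Applying the isometry of the sheet of \<open>y'\<close> to both vectors leaves only \<open>h\<close>.\<close>
      then have "a = ?N (twist h (cone_section y) - cone_section y')"
        using lq_sum_norm_twist[OF s'(1), of q "twist (inv ?g) (cone_section y)"
            "twist (inv ?g') (cone_section y')"] s'(1)
        by (simp add: a \<tau>_def norm_dist_def)
      then show ?thesis using \<rho>(3)[OF s(4) s'(4) h] by simp
    qed
    have transition: "\<exists>t. isometry_onto UNIV (norm_dist ?N) UNIV (norm_dist ?N) t \<and>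
           (\<forall>y\<in>wd.mcball x n \<inter> wd.mcball x' n. \<forall>e.
              \<tau> x (inv_into (Sigma (wd.mcball x' n) ?F) (\<tau> x') (y, e)) = (y, t e))"
      if x: "x \<in> X - K" "x' \<in> X - K" and ne: "wd.mcball x n \<inter> wd.mcball x' n \<noteq> {}" for x x'
    proof -
      define k where "k y = inv (sheet x y) \<otimes> sheet x' y" for y
      have k: "k y \<in> carrier G" "len (k y) \<le> 2 * n" "lin_dist (act (k y) x') x \<le> 2 * n + 2"
        if y: "y \<in> wd.mcball x n \<inter> wd.mcball x' n" for y
      proof -
        let ?g = "sheet x y" and ?g' = "sheet x' y"
        have s: "?g \<in> carrier G" "len ?g \<le> n" "len ?g + lin_dist (act ?g x) y < n + 1"
          "?g' \<in> carrier G" "len ?g' \<le> n" "len ?g' + lin_dist (act ?g' x') y < n + 1"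
          "y \<in> X" "x \<in> X" "x' \<in> X"
          by (rule sheet[OF IntD1[OF y]] sheet[OF IntD2[OF y]])+
        show "k y \<in> carrier G" using s by (simp add: k_def)
        show "len (k y) \<le> 2 * n"
          using word_length_mult[of "inv ?g" ?g'] s by (simp add: k_def)
        have "lin_dist (act (k y) x') x = lin_dist (act ?g (act (k y) x')) (act ?g x)"
          using s by (simp add: k_def)
        also have "act ?g (act (k y) x') = act ?g' x'"
          using s by (simp add: k_def act_mult)
        also have "lin_dist (act ?g' x') (act ?g x) \<le> lin_dist (act ?g' x') y + lin_dist (act ?g x) y"
          using ld.triangle[of "act ?g' x'" y "act ?g x"] s by (simp add: ld.commute[of y])
        finally show "lin_dist (act (k y) x') x \<le> 2 * n + 2" using s(3,6) by simp
      qed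
      obtain y0 where y0: "y0 \<in> wd.mcball x n \<inter> wd.mcball x' n" using ne by blast
      \<comment> \<open>Each \<open>k y\<close> carries \<open>x'\<close> near \<open>x\<close>, which determines it.\<close>
      have const: "k y = k y0" if y: "y \<in> wd.mcball x n \<inter> wd.mcball x' n" for y
      proof (rule unique[OF x(2) k(1)[OF y] k(1)[OF y0]])
        show "len (k y) + len (k y0) \<le> 4 * n + 4" using k(2)[OF y] k(2)[OF y0] by simp
        show "lin_dist (act (k y) x') (act (k y0) x') \<le> real (4 * n + 4)"
          using ld.triangle[of "act (k y) x'" x "act (k y0) x'"] k[OF y] k[OF y0] x
          by (simp add: ld.commute[of x])
      qed
      have "\<tau> x (inv_into (Sigma (wd.mcball x' n) ?F) (\<tau> x') (y, e)) = (y, twist (k y0) e)"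
        if y: "y \<in> wd.mcball x n \<inter> wd.mcball x' n" for y e
      proof -
        have c: "sheet x y \<in> carrier G" "sheet x' y \<in> carrier G"
          using y sheet(1)[of y x] sheet(1)[of y x'] by auto
        have "inj_on (\<tau> x') (Sigma (wd.mcball x' n) ?F)"
        proof (rule inj_on_inverseI[where g = "\<lambda>(z, u). (z, twist (sheet x' z) u)"])
          fix b assume "b \<in> Sigma (wd.mcball x' n) ?F"
          then have "fst b \<in> wd.mcball x' n" by (cases b) (simp only: mem_Sigma_iff fst_conv)
          then have "sheet x' (fst b) \<in> carrier G" by (rule sheet(1))
          then show "(case \<tau> x' b of (z, u) \<Rightarrow> (z, twist (sheet x' z) u)) = b"
            by (simp add: \<tau>_def split_beta)
        qed
        moreover have "(y, e) = \<tau> x' (y, twist (sheet x' y) e)" using c by (simp add: \<tau>_def)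
        ultimately have "inv_into (Sigma (wd.mcball x' n) ?F) (\<tau> x') (y, e) = (y, twist (sheet x' y) e)"
          using y by (metis (no_types, lifting) IntD2 SigmaI UNIV_I inv_into_f_f)
        then show ?thesis
          using c unfolding const[OF y, symmetric] by (simp add: \<tau>_def k_def twist_mult)
      qed
      then show ?thesis using isometry_twist[OF k(1)[OF y0]] by blast
    qed
    show ?thesis
      using mbounded_bottom[of R] triv control transition
      by (intro exI[of _ K] exI[of _ \<tau>] conjI ballI impI) (auto simp: K_def)
  qed
  show ?thesis
    unfolding fibred_coarsely_embeds_def Let_def
  proof (rule exI[of _ ?F], rule exI[of _ ?\<delta>], rule exI[of _ "\<lambda>_. cone_section"],
      rule exI[of _ \<rho>m], rule exI[of _ \<rho>p], intro conjI ballI allI)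
    show "\<exists>h. isometry_onto UNIV (norm_dist ?N) UNIV (norm_dist ?N) h" if "x \<in> X" for x
      by (rule exI[of _ id]) (simp add: isometry_onto_def)
  qed (use \<rho>(1,2) local in auto)
qed

end

theorem corollary3p15:
  fixes G :: "('g, 'm) monoid_scheme"
    and S :: "'g set"
    and Y :: "'y::metric_space set"
    and \<phi> :: "'g \<Rightarrow> 'y \<Rightarrow> 'y"
    and q :: ereal
  assumes "group G"
    and "finite_generating_set G S"
    and "compact Y"
    and "diameter Y > 0"
    and "continuous_action G Y \<phi>"
    and "free_action G Y \<phi>"
    and "linearisable_in G Y \<phi> TYPE('e1::banach)"
    and "property_PE G TYPE('e2::banach)"
    and "1 \<le> q"
  shows "fibred_coarsely_embeds (infinite_cone Y) (warped_dist S Y \<phi>)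
           (lq_sum_norm q :: real \<times> 'e1 \<times> 'e2 \<Rightarrow> real)"
proof -
  obtain \<pi> :: "'g \<Rightarrow> 'e1 \<Rightarrow> 'e1" and f :: "'y \<Rightarrow> 'e1" where
    rep: "isometric_representation G \<pi>" and bl: "bi_lipschitz_embedding Y f"
    and eq: "\<And>g y. g \<in> carrier G \<Longrightarrow> y \<in> Y \<Longrightarrow> f (\<phi> g y) = \<pi> g (f y)"
    using assms(7) unfolding linearisable_in_def by blast
  obtain c C where cC: "0 < c" "0 < C"
    "\<And>y y'. y \<in> Y \<Longrightarrow> y' \<in> Y \<Longrightarrow> c * dist y y' \<le> norm (f y - f y')"
    "\<And>y y'. y \<in> Y \<Longrightarrow> y' \<in> Y \<Longrightarrow> norm (f y - f y') \<le> C * dist y y'"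
    using bl unfolding bi_lipschitz_embedding_def dist_norm by blast
  obtain \<alpha> :: "'g \<Rightarrow> 'e2 \<Rightarrow> 'e2" where \<alpha>: "isometric_affine_action G \<alpha>"
    "\<And>v w r. finite {g \<in> carrier G. \<alpha> g v \<in> ball w r}"
    using assms(8) unfolding property_PE_def by blast
  interpret group G by (rule assms(1))
  interpret proper_linearised_action G S Y \<phi> \<pi> f c C \<alpha>
    by unfold_locales (use assms rep cC eq \<alpha> in auto)
  show ?thesis by (rule warped_cone_fibred_coarsely_embeds[OF assms(9)])
qed

end
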